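(* For every integer $n\ge2$ and all $k_1,\dots,k_n\in\mathbb{N}_0$, $$\zeta_{\mathrm{EMS}}(-k_1,\dots,-k_n)=\sum_{i_n+j_n=k_n}\binom{k_n}{i_n}\,\zeta_{\mathrm{EMS}}(-i_n)\,\zeta_{\mathrm{EMS}}(-k_1,\dots,-k_{n-2},-k_{n-1}-j_n)$$ (the sum over $i_n,j_n\in\mathbb{N}_0$), and $$\mathfrak{h}_{k_1,\dots,k_{n-1}}(x)=(-1)^{k_1+\cdots+k_{n-1}}\left(\mathfrak{h}\,\partial_x^{k_{n-1}}\right)\cdots\left(\mathfrak{h}\,\partial_x^{k_1}\right)(\mathfrak{h})$$ in $\mathbb{C}[[x]]$, where $\mathfrak{h}\,\partial_x^{k}$ denotes the operator $g\mapsto \mathfrak{h}\cdot\partial_x^{k}g$ on $\mathbb{C}[[x]]$.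
   Context: $\mathbb{N}_0=\{0,1,2,\dots\}$. **Generating functions.** In $\mathbb{C}[[x]]$, $$\mathfrak{h}=\mathfrak{h}(x):=\sum_{k=0}^\infty\frac{(-x)^k}{k!}\zeta_{\mathrm{EMS}}(-k),\qquad \mathfrak{h}_{k_1,\dots,k_{n-1}}(x):=\sum_{k_n=0}^\infty\frac{(-x)^{k_n}}{k_n!}\zeta_{\mathrm{EMS}}(-k_1,\dots,-k_n)\quad(n\ge2).$$ **Renormalized values.** Let $L=\{d,y\}$, let $L^*$ be the free monoid on $L$ with unit the empty word $\mathbf{1}$, and $\mathbb{Q}\langle L\rangle$ the $\mathbb{Q}$-span of $L^*$. Put $Y:=L^*y\cup\{\mathbf{1}\}$. Define a $\mathbb{Q}$-bilinear product $\sqcup\!\sqcup_0$ on $\mathbb{Q}\langle L\rangle$ recursively, for words $u,v,w\in L^*$, by $\mathbf 1\sqcup\!\sqcup_0 w=w\sqcup\!\sqcup_0\mathbf 1=w$; $\ yu\sqcup\!\sqcup_0 v=u\sqcup\!\sqcup_0 yv=y(u\sqcup\!\sqcup_0 v)$; $\ du\sqcup\!\sqcup_0 dv=d(u\sqcup\!\sqcup_0 dv)-u\sqcup\!\sqcup_0 d^2v$. Let $\mathcal{T}_-$ be the linear span of $\{wd\mid w\in L^*\}$; let $\mathcal{L}_-$ be the two-sided ideal of $(\mathbb{Q}\langle L\rangle,\sqcup\!\sqcup_0)$ generated by all $d^k\{d(u\sqcup\!\sqcup_0 v)-du\sqcup\!\sqcup_0 v-u\sqcup\!\sqcup_0 dv\}$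 with $k\in\mathbb{N}_0$, $u,v\in L^*$; put $\mathcal{S}_-:=\mathcal{T}_-+\mathcal{L}_-$ (a two-sided ideal) and $\mathcal{H}_0:=\mathbb{Q}\langle L\rangle/\mathcal{S}_-$. It is known (Ebrahimi-Fard–Manchon–Singer) that $\mathcal{H}_0$ is a connected filtered commutative and cocommutative Hopf algebra with product $\sqcup\!\sqcup_0$ and coproduct given, for $w=x_1\cdots x_N\in Y\setminus\{\mathbf 1\}$ ($x_i\in L$), by $\Delta_0(w)=\sum_{S}w_S\otimes w_{\overline S}$, the sum being over all $S\subset\{1,\dots,N\}$ (possibly empty) such that $w_S,w_{\overline S}\in Y$, where $\overline S$ is the complement of $S$ and $w_S:=x_{i_1}\cdots x_{i_r}$ for $S=\{i_1<\cdots<i_r\}$. The counit $\varepsilon$ satisfies $\varepsilon(\mathbf 1)=1$ and $\varepsilon(w)=0$ for $w\in Y\setminus\{\mathbf 1\}$. Let $\mathcal{A}:=\mathbb{Q}[[z]][\frac1z]=\mathcal{A}_-\oplus\mathcal{A}_+$ with $\mathcal{A}_-=\frac1z\mathbb{Q}[\frac1z]$, $\mathcal{A}_+=\mathbb{Q}[[z]]$. For linear maps $\alpha,\beta:\mathcal{H}_0\to\mathcal{A}$ the convolution is $\alpha*\beta:=m_{\mathcal{A}}\circ(\alpha\otimes\beta)\circ\Delta_0$; the linear maps with $\mathbf 1\mapsto1$ form a group under $*$. Let $\phi:\mathcal{H}_0\to\mathcal{A}$ be the linear map with $\phi(\mathbf 1)=1$ and $\phi(d^{k_1}y\cdots d^{k_n}y)(z)=\partial_z^{k_1}(\xi\partial_z^{k_2})\cdots(\xi\partial_z^{k_n})(\xi)$,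 $\xi=\xi(z)=\frac{e^z}{1-e^z}$ (known to be a well-defined algebra homomorphism). By the algebraic Birkhoff decomposition there are unique linear maps $\phi_+:\mathcal{H}_0\to\mathcal{A}_+$ and $\phi_-:\mathcal{H}_0\to\mathbb{Q}\oplus\mathcal{A}_-$ with $\phi_-(\mathbf 1)=1$, $\phi_-(\ker\varepsilon)\subset\mathcal{A}_-$ and $\phi=\phi_-^{-1}*\phi_+$ (inverse with respect to $*$); both are algebra homomorphisms. The renormalized value is $$\zeta_{\mathrm{EMS}}(-k_1,\dots,-k_n):=\lim_{z\to0}\phi_+(d^{k_n}y\cdots d^{k_1}y)(z)\qquad(k_1,\dots,k_n\in\mathbb{N}_0).$$ *)

theory Defs
  imports
    Complex_Main
    "HOL-Library.Poly_Mapping"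
    "HOL-Computational_Algebra.Formal_Laurent_Series"
begin

section \<open>Words and the product on \<open>\<rat>\<langle>L\<rangle>\<close>\<close>

datatype letter = Ld | Ly

type_synonym word = "letter list"

text \<open>Finitely supported functions \<open>'a \<Rightarrow>\<^sub>0 rat\<close> serve as the rational vector space with basis
  \<open>'a\<close>; \<open>basis a\<close> is the basis vector and \<open>qscale\<close> the scalar multiplication.\<close>

definition qscale :: "rat \<Rightarrow> ('a \<Rightarrow>\<^sub>0 rat) \<Rightarrow> ('a \<Rightarrow>\<^sub>0 rat)" where
  "qscale c p = Poly_Mapping.map ((*) c) p"

abbreviation basis :: "'a \<Rightarrow> ('a \<Rightarrow>\<^sub>0 rat)" where
  "basis a \<equiv> Poly_Mapping.single a 1"

lemma lookup_qscale [simp]: "Poly_Mapping.lookup (qscale c p) a = c * Poly_Mapping.lookup p a"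
  unfolding qscale_def by transfer (simp add: when_def)

interpretation qvs: vector_space "qscale :: rat \<Rightarrow> ('a \<Rightarrow>\<^sub>0 rat) \<Rightarrow> ('a \<Rightarrow>\<^sub>0 rat)"
  by standard (auto intro!: poly_mapping_eqI simp: lookup_add algebra_simps)

definition linext :: "('a \<Rightarrow> ('b \<Rightarrow>\<^sub>0 rat)) \<Rightarrow> ('a \<Rightarrow>\<^sub>0 rat) \<Rightarrow> ('b \<Rightarrow>\<^sub>0 rat)" where
  "linext F p = (\<Sum>a\<in>Poly_Mapping.keys p. qscale (Poly_Mapping.lookup p a) (F a))"

definition prefix :: "letter \<Rightarrow> (word \<Rightarrow>\<^sub>0 rat) \<Rightarrow> (word \<Rightarrow>\<^sub>0 rat)" where
  "prefix x = linext (\<lambda>w. basis (x # w))"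

fun wshuffle :: "word \<Rightarrow> word \<Rightarrow> (word \<Rightarrow>\<^sub>0 rat)" where
  "wshuffle [] w = basis w"
| "wshuffle w [] = basis w"
| "wshuffle (Ly # u) v = prefix Ly (wshuffle u v)"
| "wshuffle u (Ly # v) = prefix Ly (wshuffle u v)"
| "wshuffle (Ld # u) (Ld # v) =
     prefix Ld (wshuffle u (Ld # v)) - wshuffle u (Ld # Ld # v)"

text \<open>The equations for \<open>Ly\<close> above overlap and are applied in order; both nevertheless hold
  for all words.\<close>

lemma prefix_basis [simp]: "prefix x (basis w) = basis (x # w)"
  by (auto intro!: poly_mapping_eqI simp: prefix_def linext_def)

lemma wshuffle_Nil_right: "wshuffle w [] = basis w"
  by (cases w) auto

lemma wshuffle_y_left: "wshuffle (Ly # u) v = prefix Ly (wshuffle u v)"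
  by (cases v) (auto simp: wshuffle_Nil_right)

lemma wshuffle_y_right: "wshuffle u (Ly # v) = prefix Ly (wshuffle u v)"
proof (induction u)
  case (Cons a u)
  then show ?case by (cases a) (auto simp: wshuffle_y_left)
qed simp

definition shuffle :: "(word \<Rightarrow>\<^sub>0 rat) \<Rightarrow> (word \<Rightarrow>\<^sub>0 rat) \<Rightarrow> (word \<Rightarrow>\<^sub>0 rat)" where
  "shuffle p q = linext (\<lambda>u. linext (\<lambda>v. wshuffle u v) q) p"


section \<open>The quotient space \<open>\<H>\<^sub>0\<close>\<close>

definition Y_words :: "word set" where
  "Y_words = {w @ [Ly] | w. True} \<union> {[]}"

definition T_minus :: "(word \<Rightarrow>\<^sub>0 rat) set" where
  "T_minus = qvs.span {basis (w @ [Ld]) | w. True}"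

definition shuffle_ideal :: "(word \<Rightarrow>\<^sub>0 rat) set \<Rightarrow> bool" where
  "shuffle_ideal I \<longleftrightarrow> qvs.subspace I \<and> (\<forall>p\<in>I. \<forall>q. shuffle p q \<in> I \<and> shuffle q p \<in> I)"

definition L_minus_gens :: "(word \<Rightarrow>\<^sub>0 rat) set" where
  "L_minus_gens =
     {(prefix Ld ^^ k) (prefix Ld (wshuffle u v) - wshuffle (Ld # u) v - wshuffle u (Ld # v))
      | k u v. True}"

definition L_minus :: "(word \<Rightarrow>\<^sub>0 rat) set" where
  "L_minus = \<Inter>{I. shuffle_ideal I \<and> L_minus_gens \<subseteq> I}"

definition S_minus :: "(word \<Rightarrow>\<^sub>0 rat) set" where
  "S_minus = {t + l | t l. t \<in> T_minus \<and> l \<in> L_minus}"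

lemma subspace_S_minus: "qvs.subspace S_minus"
proof -
  have "qvs.subspace L_minus"
    unfolding L_minus_def shuffle_ideal_def by (rule qvs.subspace_Inter) auto
  moreover have "qvs.subspace T_minus"
    unfolding T_minus_def by (rule qvs.subspace_span)
  ultimately show ?thesis
    unfolding S_minus_def by (rule qvs.subspace_sums[rotated])
qed

lemma equivp_subspace:
  assumes "qvs.subspace V"
  shows "equivp (\<lambda>p q. p - q \<in> V)"
proof (rule equivpI)
  show "reflp (\<lambda>p q. p - q \<in> V)"
    by (rule reflpI) (simp add: qvs.subspace_0[OF assms])
  show "symp (\<lambda>p q. p - q \<in> V)"
    by (rule sympI) (metis assms minus_diff_eq qvs.subspace_neg)
  show "transp (\<lambda>p q. p - q \<in> V)"
    by (rule transpI) (metis assms diff_add_cancel add_diff_eq qvs.subspace_add)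
qed

lemma subspace_quot_rules:
  assumes "qvs.subspace V"
  shows "a - a' \<in> V \<Longrightarrow> b - b' \<in> V \<Longrightarrow> a + b - (a' + b') \<in> V"
    and "a - a' \<in> V \<Longrightarrow> b - b' \<in> V \<Longrightarrow> a - b - (a' - b') \<in> V"
    and "a - a' \<in> V \<Longrightarrow> - a - - a' \<in> V"
    and "a - a' \<in> V \<Longrightarrow> qscale c a - qscale c a' \<in> V"
  using qvs.subspace_add[OF assms, of "a - a'" "b - b'"]
    qvs.subspace_diff[OF assms, of "a - a'" "b - b'"]
    qvs.subspace_neg[OF assms, of "a - a'"]
    qvs.subspace_scale[OF assms, of "a - a'" c]
  by (simp_all add: algebra_simps)

quotient_type H0 = "word \<Rightarrow>\<^sub>0 rat" / "\<lambda>p q. p - q \<in> S_minus"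
  by (rule equivp_subspace[OF subspace_S_minus])

instantiation H0 :: ab_group_add
begin

lift_definition zero_H0 :: H0 is 0 .
lift_definition plus_H0 :: "H0 \<Rightarrow> H0 \<Rightarrow> H0" is "(+)"
  by (rule subspace_quot_rules[OF subspace_S_minus])
lift_definition minus_H0 :: "H0 \<Rightarrow> H0 \<Rightarrow> H0" is "(-)"
  by (rule subspace_quot_rules[OF subspace_S_minus])
lift_definition uminus_H0 :: "H0 \<Rightarrow> H0" is uminus
  by (rule subspace_quot_rules[OF subspace_S_minus])

instance
  by standard
    (transfer; simp add: algebra_simps qvs.subspace_0[OF subspace_S_minus])+

end

lift_definition hscale :: "rat \<Rightarrow> H0 \<Rightarrow> H0" is qscale
  by (rule subspace_quot_rules[OF subspace_S_minus])

definition wclass :: "word \<Rightarrow> H0" where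
  "wclass w = abs_H0 (basis w)"

text \<open>The classes of the words in \<open>Y_words\<close> span \<open>H0\<close>, so a linear map on \<open>H0\<close> is determined
  by its values on them. The map below is the linear map (into the rational vector space with
  scalar multiplication \<open>s\<close>) with prescribed values on \<open>Y_words\<close>, whenever it exists.\<close>

definition linear_on_words :: "(rat \<Rightarrow> 'b \<Rightarrow> 'b) \<Rightarrow> (word \<Rightarrow> 'b) \<Rightarrow> H0 \<Rightarrow> 'b::ab_group_add" where
  "linear_on_words s F =
     (THE f. Vector_Spaces.linear hscale s f \<and> (\<forall>w\<in>Y_words. f (wclass w) = F w))"


section \<open>Counit and coproduct\<close>

definition counit :: "H0 \<Rightarrow> rat" where
  "counit = linear_on_words (*) (\<lambda>w. if w = [] then 1 else 0)"

text \<open>\<open>H0H0\<close> is the tensor product \<open>\<H>\<^sub>0 \<otimes> \<H>\<^sub>0\<close> over the rationals, as the quotient of the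
  free vector space on pairs by the bilinearity relations.\<close>

definition bilinear_rels :: "(H0 \<times> H0 \<Rightarrow>\<^sub>0 rat) set" where
  "bilinear_rels = qvs.span
     ({basis (a + a', b) - basis (a, b) - basis (a', b) | a a' b. True} \<union>
      {basis (a, b + b') - basis (a, b) - basis (a, b') | a b b'. True} \<union>
      {basis (hscale c a, b) - qscale c (basis (a, b)) | c a b. True} \<union>
      {basis (a, hscale c b) - qscale c (basis (a, b)) | c a b. True})"

lemma subspace_bilinear_rels: "qvs.subspace bilinear_rels"
  unfolding bilinear_rels_def by (rule qvs.subspace_span)

quotient_type H0H0 = "H0 \<times> H0 \<Rightarrow>\<^sub>0 rat" / "\<lambda>p q. p - q \<in> bilinear_rels"
  by (rule equivp_subspace[OF subspace_bilinear_rels])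

instantiation H0H0 :: ab_group_add
begin

lift_definition zero_H0H0 :: H0H0 is 0 .
lift_definition plus_H0H0 :: "H0H0 \<Rightarrow> H0H0 \<Rightarrow> H0H0" is "(+)"
  by (rule subspace_quot_rules[OF subspace_bilinear_rels])
lift_definition minus_H0H0 :: "H0H0 \<Rightarrow> H0H0 \<Rightarrow> H0H0" is "(-)"
  by (rule subspace_quot_rules[OF subspace_bilinear_rels])
lift_definition uminus_H0H0 :: "H0H0 \<Rightarrow> H0H0" is uminus
  by (rule subspace_quot_rules[OF subspace_bilinear_rels])

instance
  by standard
    (transfer; simp add: algebra_simps qvs.subspace_0[OF subspace_bilinear_rels])+

end

lift_definition hhscale :: "rat \<Rightarrow> H0H0 \<Rightarrow> H0H0" is qscale
  by (rule subspace_quot_rules[OF subspace_bilinear_rels])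

definition tensor :: "H0 \<Rightarrow> H0 \<Rightarrow> H0H0" where
  "tensor a b = abs_H0H0 (basis (a, b))"

text \<open>Positions in a word are counted from 0, as in \<^const>\<open>nths\<close>. For the empty word the sum
  below is \<open>\<one> \<otimes> \<one>\<close>.\<close>

definition coproduct :: "H0 \<Rightarrow> H0H0" where
  "coproduct = linear_on_words hhscale (\<lambda>w.
     \<Sum>S \<in> {S. S \<subseteq> {..<length w} \<and> nths w S \<in> Y_words \<and> nths w ({..<length w} - S) \<in> Y_words}.
       tensor (wclass (nths w S)) (wclass (nths w ({..<length w} - S))))"


section \<open>Convolution and the Birkhoff decomposition\<close>

text \<open>The algebra \<open>\<A> = \<rat>[[z]][1/z]\<close> is the type \<^typ>\<open>rat fls\<close>.\<close>

definition A_plus :: "rat fls set" where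
  "A_plus = {f. \<forall>n<0. fls_nth f n = 0}"

definition A_minus :: "rat fls set" where
  "A_minus = {f. \<forall>n\<ge>0. fls_nth f n = 0}"

definition ascale :: "rat \<Rightarrow> rat fls \<Rightarrow> rat fls" where
  "ascale c f = fls_const c * f"

abbreviation linear_HA :: "(H0 \<Rightarrow> rat fls) \<Rightarrow> bool" where
  "linear_HA \<equiv> Vector_Spaces.linear hscale ascale"

text \<open>\<open>mult_tensor \<alpha> \<beta>\<close> is \<open>m\<^sub>\<A> \<circ> (\<alpha> \<otimes> \<beta>)\<close>, for linear \<open>\<alpha>\<close> and \<open>\<beta>\<close>.\<close>

definition mult_tensor :: "(H0 \<Rightarrow> rat fls) \<Rightarrow> (H0 \<Rightarrow> rat fls) \<Rightarrow> H0H0 \<Rightarrow> rat fls" where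
  "mult_tensor \<alpha> \<beta> =
     (THE f. Vector_Spaces.linear hhscale ascale f \<and> (\<forall>a b. f (tensor a b) = \<alpha> a * \<beta> b))"

definition conv :: "(H0 \<Rightarrow> rat fls) \<Rightarrow> (H0 \<Rightarrow> rat fls) \<Rightarrow> H0 \<Rightarrow> rat fls" where
  "conv \<alpha> \<beta> = mult_tensor \<alpha> \<beta> \<circ> coproduct"

definition conv_unit :: "H0 \<Rightarrow> rat fls" where
  "conv_unit h = fls_const (counit h)"

definition conv_inverse :: "(H0 \<Rightarrow> rat fls) \<Rightarrow> H0 \<Rightarrow> rat fls" where
  "conv_inverse \<alpha> =
     (THE \<beta>. linear_HA \<beta> \<and> \<beta> (wclass []) = 1 \<and> conv \<alpha> \<beta> = conv_unit \<and> conv \<beta> \<alpha> = conv_unit)"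

definition xi :: "rat fls" where
  "xi = fps_to_fls (fps_exp 1) / (1 - fps_to_fls (fps_exp 1))"

text \<open>\<open>dy_word [k\<^sub>1, \<dots>, k\<^sub>n]\<close> is the word \<open>d\<^bsup>k\<^sub>1\<^esup> y \<cdots> d\<^bsup>k\<^sub>n\<^esup> y\<close>.\<close>

definition dy_word :: "nat list \<Rightarrow> word" where
  "dy_word ks = concat (map (\<lambda>k. replicate k Ld @ [Ly]) ks)"

text \<open>The value prescribed below is \<open>\<partial>\<^bsup>k\<^sub>1\<^esup>(\<xi> \<partial>\<^bsup>k\<^sub>2\<^esup>(\<xi> \<cdots> \<partial>\<^bsup>k\<^sub>n\<^esup>(\<xi> \<cdot> 1)))\<close>, which for
  \<open>n = 0\<close> is the normalisation \<open>\<phi>(\<one>) = 1\<close>.\<close>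

definition phi :: "H0 \<Rightarrow> rat fls" where
  "phi = (THE f. linear_HA f \<and>
     (\<forall>ks. f (wclass (dy_word ks)) = foldr (\<lambda>k g. (fls_deriv ^^ k) (xi * g)) ks 1))"

definition birkhoff :: "(H0 \<Rightarrow> rat fls) \<Rightarrow> (H0 \<Rightarrow> rat fls) \<Rightarrow> bool" where
  "birkhoff \<phi>p \<phi>m \<longleftrightarrow>
     linear_HA \<phi>p \<and> (\<forall>h. \<phi>p h \<in> A_plus) \<and>
     linear_HA \<phi>m \<and> (\<forall>h. \<phi>m h \<in> {fls_const c + a | c a. a \<in> A_minus}) \<and>
     \<phi>m (wclass []) = 1 \<and> (\<forall>h. counit h = 0 \<longrightarrow> \<phi>m h \<in> A_minus) \<and>
     phi = conv (conv_inverse \<phi>m) \<phi>p"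

definition phi_plus :: "H0 \<Rightarrow> rat fls" where
  "phi_plus = fst (THE (\<phi>p, \<phi>m). birkhoff \<phi>p \<phi>m)"


section \<open>Renormalized values and generating functions\<close>

text \<open>\<open>zeta_EMS [k\<^sub>1, \<dots>, k\<^sub>n]\<close> is \<open>\<zeta>\<^sub>E\<^sub>M\<^sub>S(-k\<^sub>1, \<dots>, -k\<^sub>n)\<close>: note the signs, and the reversal of
  the arguments. The limit \<open>z \<rightarrow> 0\<close> of a formal power series is its constant coefficient.\<close>

definition zeta_EMS :: "nat list \<Rightarrow> rat" where
  "zeta_EMS ks = fls_nth (phi_plus (wclass (dy_word (rev ks)))) 0"

text \<open>\<open>h_EMS [k\<^sub>1, \<dots>, k\<^bsub>n-1\<^esub>]\<close> is the generating function with these indices; \<open>h_EMS []\<close> is the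
  one without indices (\<open>n = 1\<close>).\<close>

definition h_EMS :: "nat list \<Rightarrow> complex fps" where
  "h_EMS ks = Abs_fps (\<lambda>k. (-1) ^ k / fact k * of_rat (zeta_EMS (ks @ [k])))"

definition h_op :: "nat \<Rightarrow> complex fps \<Rightarrow> complex fps" where
  "h_op k g = h_EMS [] * (fps_deriv ^^ k) g"

end

theory Submission
  imports Defs
begin

text \<open>Let words act on an algebra with a derivation \<open>D\<close> and a distinguished element \<open>\<eta>\<close>, the letter
  \<open>d\<close> by \<open>D\<close> and \<open>y\<close> by multiplication with \<open>\<eta>\<close>. Then \<open>w \<mapsto> w \<cdot> 1\<close> is multiplicative for the
  product of words and vanishes on the ideal, so it descends to \<open>\<H>\<^sub>0\<close>. Over \<open>\<H>\<^sub>0 \<otimes> \<H>\<^sub>0\<close> with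
  \<open>\<eta> = y \<otimes> 1 + 1 \<otimes> y\<close> this gives the coproduct, and over \<open>\<A>\<close> with \<open>D = \<partial>\<^sub>z\<close> it gives a character
  \<open>\<chi>\<^sub>\<eta>\<close> for every \<open>\<eta> \<in> \<A>\<close>; in particular \<open>\<phi> = \<chi>\<^sub>\<xi>\<close>. These characters satisfy
  \<open>\<chi>\<^sub>\<eta> * \<chi>\<^sub>\<theta> = \<chi>\<^bsub>\<eta>+\<theta>\<^esub>\<close>. Since \<open>\<partial>\<^sub>z\<close> preserves both \<open>\<A>\<^sub>+\<close> and \<open>\<A>\<^sub>-\<close>, splitting
  \<open>\<xi> = \<xi>\<^sub>- + \<xi>\<^sub>+\<close> yields the Birkhoff decomposition, with \<open>\<phi>\<^sub>+\<close> the character of \<open>\<xi>\<^sub>+\<close>. So the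
  renormalized value is the constant term of
  \<open>\<partial>\<^bsup>k\<^sub>n\<^esup>(\<xi>\<^sub>+ \<cdots> \<partial>\<^bsup>k\<^sub>1\<^esup>(\<xi>\<^sub>+))\<close>; the recursion is the Leibniz rule, and its generating
  function form is the second claim.\<close>

section \<open>Linear maps on free vector spaces\<close>

lemmas linear_add = module_hom.add[OF module_hom_linearI]
  and linear_diff = module_hom.diff[OF module_hom_linearI]
  and linear_zero = module_hom.zero[OF module_hom_linearI]
  and linear_scale = module_hom.scale[OF module_hom_linearI]
  and linear_sum = module_hom.sum[OF module_hom_linearI]

lemma linear_vector_space:
  assumes "Vector_Spaces.linear s1 s2 f"
  shows "vector_space s1" "vector_space s2"
  using assms by (simp_all add: Vector_Spaces.linear_iff)

text \<open>Generalises \<open>linext\<close> to targets that are not free, such as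
  \<open>H0H0\<close> and \<open>rat fls\<close>; the scalar multiplication of the target is a
  parameter.\<close>

definition extend :: "(rat \<Rightarrow> 'b \<Rightarrow> 'b) \<Rightarrow> ('a \<Rightarrow> 'b::ab_group_add) \<Rightarrow> ('a \<Rightarrow>\<^sub>0 rat) \<Rightarrow> 'b" where
  "extend s G p = (\<Sum>a\<in>Poly_Mapping.keys p. s (Poly_Mapping.lookup p a) (G a))"

lemma linext_eq_extend: "linext = extend qscale"
  by (intro ext) (simp add: linext_def extend_def)

context
  fixes s :: "rat \<Rightarrow> 'b \<Rightarrow> 'b::ab_group_add"
  assumes vs: "vector_space s"
begin

interpretation vector_space s by (fact vs)

lemma extend_superset:
  assumes "finite A" "Poly_Mapping.keys p \<subseteq> A"
  shows "extend s G p = (\<Sum>a\<in>A. s (Poly_Mapping.lookup p a) (G a))"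
  unfolding extend_def using assms
  by (intro sum.mono_neutral_left) (auto simp: in_keys_iff)

lemma linear_extend: "Vector_Spaces.linear qscale s (extend s G)"
proof -
  have "extend s G (p + q) = extend s G p + extend s G q" for p q
  proof -
    let ?A = "Poly_Mapping.keys p \<union> Poly_Mapping.keys q"
    have "extend s G r = (\<Sum>a\<in>?A. s (Poly_Mapping.lookup r a) (G a))"
      if "r \<in> {p, q, p + q}" for r
      using that Poly_Mapping.keys_add[of p q] by (intro extend_superset) auto
    then show ?thesis
      by (simp add: lookup_add scale_left_distrib sum.distrib)
  qed
  moreover have "extend s G (qscale c p) = s c (extend s G p)" for c p
  proof -
    have "Poly_Mapping.keys (qscale c p) \<subseteq> Poly_Mapping.keys p"
      by (auto simp: in_keys_iff)
    then show ?thesis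
      using extend_superset[of "Poly_Mapping.keys p" "qscale c p" G]
      by (simp add: extend_def scale_sum_right)
  qed
  ultimately show ?thesis
    by (simp add: Vector_Spaces.linear_iff vs qvs.vector_space_axioms)
qed

lemma extend_basis [simp]: "extend s G (basis a) = G a"
  by (simp add: extend_def)

end

text \<open>Reduces linear and bilinear identities to words. Zero is covered as the zero multiple of
  a basis vector.\<close>

lemma free_induct [case_names basis add scale]:
  assumes "\<And>a. P (basis a)" "\<And>p q. P p \<Longrightarrow> P q \<Longrightarrow> P (p + q)" "\<And>c p. P p \<Longrightarrow> P (qscale c p)"
  shows "P p"
proof -
  have eq: "p = (\<Sum>a\<in>Poly_Mapping.keys p. qscale (Poly_Mapping.lookup p a) (basis a))"
    by (rule poly_mapping_eqI)
      (auto simp: lookup_sum lookup_single when_def in_keys_iff if_distrib cong: if_cong)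
  have P0: "P 0"
    using assms(3)[of "basis undefined" 0] assms(1) by simp
  have "P (\<Sum>a\<in>A. qscale (Poly_Mapping.lookup p a) (basis a))" if "finite A" for A
    using that by induction (auto intro: assms P0)
  then show ?thesis
    by (subst eq) simp
qed

lemma linear_prefix: "Vector_Spaces.linear qscale qscale (prefix x)"
  unfolding prefix_def linext_eq_extend by (rule linear_extend) unfold_locales

text \<open>In \<open>shuffle p q\<close> the argument \<open>q\<close> sits inside the function
  being extended, so linearity on the right rests on linearity of \<open>extend\<close> in that
  function.\<close>

lemma extend_linear_fun:
  assumes "vector_space s"
  shows "extend s (\<lambda>a. s c (G a)) p = s c (extend s G p)"
    and "extend s (\<lambda>a. G a + H a) p = extend s G p + extend s H p"
proof -
  interpret vector_space s by fact
  show "extend s (\<lambda>a. s c (G a)) p = s c (extend s G p)"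
    by (simp add: extend_def scale_sum_right mult.commute)
  show "extend s (\<lambda>a. G a + H a) p = extend s G p + extend s H p"
    by (simp add: extend_def scale_right_distrib sum.distrib)
qed

lemma linear_shuffle_left: "Vector_Spaces.linear qscale qscale (\<lambda>p. shuffle p q)"
  unfolding shuffle_def linext_eq_extend by (rule linear_extend) unfold_locales

lemma linear_shuffle_right: "Vector_Spaces.linear qscale qscale (shuffle p)"
proof -
  note lin = linear_extend[OF qvs.vector_space_axioms]
  show ?thesis
    unfolding shuffle_def linext_eq_extend
    by (simp add: Vector_Spaces.linear_iff qvs.vector_space_axioms
        extend_linear_fun[OF qvs.vector_space_axioms] linear_add[OF lin] linear_scale[OF lin])
qed

lemma shuffle_basis [simp]: "shuffle (basis u) (basis v) = wshuffle u v"
  by (simp add: shuffle_def linext_eq_extend extend_basis qvs.vector_space_axioms)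

lemmas prefix_linear_simps =
  linear_add[OF linear_prefix] linear_scale[OF linear_prefix] linear_diff[OF linear_prefix]
  linear_zero[OF linear_prefix]
lemmas shuffle_linear_simps =
  linear_add[OF linear_shuffle_left] linear_scale[OF linear_shuffle_left]
  linear_diff[OF linear_shuffle_left] linear_zero[OF linear_shuffle_left]
  linear_add[OF linear_shuffle_right] linear_scale[OF linear_shuffle_right]
  linear_diff[OF linear_shuffle_right] linear_zero[OF linear_shuffle_right]

section \<open>The ideal \<open>\<L>\<^sub>-\<close>\<close>

lemma shuffle_prefix_y_left: "shuffle (prefix Ly p) q = prefix Ly (shuffle p q)"
proof (induction p rule: free_induct)
  case (basis u)
  show ?case
    by (induction q rule: free_induct)
      (simp_all add: wshuffle_y_left prefix_linear_simps shuffle_linear_simps)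
qed (simp_all add: prefix_linear_simps shuffle_linear_simps)

lemma shuffle_prefix_y_right: "shuffle p (prefix Ly q) = prefix Ly (shuffle p q)"
proof (induction p rule: free_induct)
  case (basis u)
  show ?case
    by (induction q rule: free_induct)
      (simp_all add: wshuffle_y_right prefix_linear_simps shuffle_linear_simps)
qed (simp_all add: prefix_linear_simps shuffle_linear_simps)

lemma shuffle_Nil [simp]: "shuffle (basis []) p = p" "shuffle p (basis []) = p"
  by (induction p rule: free_induct)
    (simp_all add: shuffle_linear_simps wshuffle_Nil_right)

text \<open>On two words this is the generator of the ideal with k = 0; it measures the failure of d
  to be a derivation.\<close>

definition leibniz_defect :: "(word \<Rightarrow>\<^sub>0 rat) \<Rightarrow> (word \<Rightarrow>\<^sub>0 rat) \<Rightarrow> (word \<Rightarrow>\<^sub>0 rat)" where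
  "leibniz_defect p q =
     prefix Ld (shuffle p q) - shuffle (prefix Ld p) q - shuffle p (prefix Ld q)"

lemma L_minus_gens_defect:
  "L_minus_gens = {(prefix Ld ^^ k) (leibniz_defect (basis u) (basis v)) | k u v. True}"
  by (simp add: L_minus_gens_def leibniz_defect_def)

lemma shuffle_ideal_L_minus: "shuffle_ideal L_minus"
proof -
  have "qvs.subspace L_minus"
    unfolding L_minus_def shuffle_ideal_def by (rule qvs.subspace_Inter) auto
  then show ?thesis
    unfolding shuffle_ideal_def by (auto simp: L_minus_def shuffle_ideal_def)
qed

lemma subspace_L_minus: "qvs.subspace L_minus"
  using shuffle_ideal_L_minus by (simp add: shuffle_ideal_def)

lemma L_minus_gens_subset: "L_minus_gens \<subseteq> L_minus"
  by (auto simp: L_minus_def)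

lemma L_minus_least: "shuffle_ideal I \<Longrightarrow> L_minus_gens \<subseteq> I \<Longrightarrow> L_minus \<subseteq> I"
  by (auto simp: L_minus_def)

text \<open>The defect is bilinear, so its values on words decide.\<close>

lemma leibniz_defect_in_subspace:
  assumes "qvs.subspace V" "\<And>u v. leibniz_defect (basis u) (basis v) \<in> V"
  shows "leibniz_defect p q \<in> V"
proof (induction p rule: free_induct)
  case (basis u)
  show ?case
  proof (induction q rule: free_induct)
    case (add p q)
    then show ?case
      using qvs.subspace_add[OF assms(1) add]
      by (simp add: leibniz_defect_def prefix_linear_simps shuffle_linear_simps algebra_simps)
  next
    case (scale c p)
    then show ?case
      using qvs.subspace_scale[OF assms(1) scale, of c]
      by (simp add: leibniz_defect_def prefix_linear_simps shuffle_linear_simps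
          qvs.scale_right_diff_distrib)
  qed (fact assms)
next
  case (add p q)
  then show ?case
    using qvs.subspace_add[OF assms(1) add]
    by (simp add: leibniz_defect_def prefix_linear_simps shuffle_linear_simps algebra_simps)
next
  case (scale c p)
  then show ?case
    using qvs.subspace_scale[OF assms(1) scale, of c]
    by (simp add: leibniz_defect_def prefix_linear_simps shuffle_linear_simps
        qvs.scale_right_diff_distrib)
qed

lemma leibniz_defect_L_minus: "leibniz_defect p q \<in> L_minus"
proof (rule leibniz_defect_in_subspace[OF subspace_L_minus])
  have "(prefix Ld ^^ 0) (leibniz_defect (basis u) (basis v)) \<in> L_minus" for u v
    using L_minus_gens_subset unfolding L_minus_gens_defect by blast
  then show "leibniz_defect (basis u) (basis v) \<in> L_minus" for u v
    by simp
qed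

section \<open>Stability of the ideal under prefixing a letter\<close>

lemma prefix_y_L_minus:
  assumes "p \<in> L_minus" shows "prefix Ly p \<in> L_minus"
proof -
  \<comment> \<open>Prefixing y is multiplication by the word y, so the ideal property
    suffices.\<close>
  have "shuffle (prefix Ly (basis [])) p \<in> L_minus"
    using assms shuffle_ideal_L_minus by (auto simp: shuffle_ideal_def)
  then show ?thesis
    by (simp only: shuffle_prefix_y_left shuffle_Nil)
qed

text \<open>The elements of the ideal that d keeps in it form an ideal again, since d of a product
  is a defect plus two products. Generators belong to it because d raises their k by one. Minimality
  of \<open>L_minus\<close> concludes.\<close>

lemma prefix_d_L_minus:
  assumes "p \<in> L_minus" shows "prefix Ld p \<in> L_minus"
proof -
  let ?I = "{p \<in> L_minus. prefix Ld p \<in> L_minus}"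
  have mult: "shuffle p q \<in> L_minus \<and> shuffle q p \<in> L_minus" if "p \<in> L_minus" for p q
    using that shuffle_ideal_L_minus by (auto simp: shuffle_ideal_def)
  have "prefix Ld (shuffle p q) \<in> L_minus"
    if "shuffle (prefix Ld p) q \<in> L_minus" "shuffle p (prefix Ld q) \<in> L_minus" for p q
    using qvs.subspace_add[OF subspace_L_minus leibniz_defect_L_minus[of p q]
        qvs.subspace_add[OF subspace_L_minus that]]
    by (simp add: leibniz_defect_def)
  then have "shuffle_ideal ?I"
    unfolding shuffle_ideal_def
    by (auto simp: qvs.subspace_def prefix_linear_simps mult
        intro: qvs.subspace_0[OF subspace_L_minus] qvs.subspace_add[OF subspace_L_minus]
          qvs.subspace_scale[OF subspace_L_minus])
  moreover have "L_minus_gens \<subseteq> ?I"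
  proof -
    have "prefix Ld g \<in> L_minus_gens" if "g \<in> L_minus_gens" for g
    proof -
      obtain k u v where "g = (prefix Ld ^^ k) (leibniz_defect (basis u) (basis v))"
        using \<open>g \<in> L_minus_gens\<close> unfolding L_minus_gens_defect by blast
      then have "prefix Ld g = (prefix Ld ^^ Suc k) (leibniz_defect (basis u) (basis v))"
        by simp
      then show ?thesis
        unfolding L_minus_gens_defect by blast
    qed
    then show ?thesis
      using L_minus_gens_subset by auto
  qed
  ultimately show ?thesis
    using L_minus_least assms by blast
qed

lemma prefix_L_minus: "p \<in> L_minus \<Longrightarrow> prefix x p \<in> L_minus"
  by (cases x) (simp_all add: prefix_y_L_minus prefix_d_L_minus)

text \<open>The generator with \<open>k = 0\<close> and \<open>u = v = \<one>\<close> is \<open>-d\<close>.\<close>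

lemma basis_snoc_d_L_minus: "basis (w @ [Ld]) \<in> L_minus"
proof (induction w)
  case Nil
  have "leibniz_defect (basis []) (basis []) = - basis [Ld]"
    by (simp add: leibniz_defect_def)
  then show ?case
    using leibniz_defect_L_minus[of "basis []" "basis []"] qvs.subspace_neg[OF subspace_L_minus]
    by fastforce
next
  case (Cons x w)
  then show ?case
    using prefix_L_minus[OF Cons, of x] by simp
qed

text \<open>Words ending in d lie in the ideal, hence so does \<open>T_minus\<close>. A linear map
  therefore descends to the quotient once it vanishes on the ideal.\<close>

lemma S_minus_eq_L_minus: "S_minus = L_minus"
proof
  have "T_minus \<subseteq> L_minus"
    unfolding T_minus_def
    by (rule qvs.span_minimal[OF _ subspace_L_minus]) (auto simp: basis_snoc_d_L_minus)
  then show "S_minus \<subseteq> L_minus"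
    unfolding S_minus_def using qvs.subspace_add[OF subspace_L_minus] by auto
  have "0 \<in> T_minus"
    unfolding T_minus_def by (rule qvs.span_zero)
  then show "L_minus \<subseteq> S_minus"
    unfolding S_minus_def by (metis (mono_tags, lifting) add_0 mem_Collect_eq subsetI)
qed

section \<open>Representations of words\<close>

text \<open>\<open>Y\<close> plays the role of multiplication by a fixed element. Neither associativity nor
  commutativity of \<open>m\<close> is assumed, as for \<open>\<H>\<^sub>0\<close> and \<open>\<H>\<^sub>0 \<otimes> \<H>\<^sub>0\<close> they would need proof.\<close>

locale differential_algebra = vector_space s
  for s :: "rat \<Rightarrow> 'b \<Rightarrow> 'b::ab_group_add" +
  fixes m :: "'b \<Rightarrow> 'b \<Rightarrow> 'b" and D Y :: "'b \<Rightarrow> 'b" and e :: 'b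
  assumes linear_m_left: "Vector_Spaces.linear s s (\<lambda>a. m a b)"
    and linear_m_right: "Vector_Spaces.linear s s (m a)"
    and linear_D: "Vector_Spaces.linear s s D"
    and linear_Y: "Vector_Spaces.linear s s Y"
    and leibniz: "D (m a b) = m (D a) b + m a (D b)"
    and Y_left: "m (Y a) b = Y (m a b)"
    and Y_right: "m a (Y b) = Y (m a b)"
    and unit_left: "m e a = a"
    and unit_right: "m a e = a"
begin

fun act :: "letter \<Rightarrow> 'b \<Rightarrow> 'b" where
  "act Ld = D"
| "act Ly = Y"

definition wval :: "word \<Rightarrow> 'b" where
  "wval w = foldr act w e"

lemma wval_Nil [simp]: "wval [] = e"
  and wval_Cons [simp]: "wval (x # w) = act x (wval w)"
  by (simp_all add: wval_def)

lemma linear_act: "Vector_Spaces.linear s s (act x)"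
  by (cases x) (simp_all add: linear_D linear_Y)

lemmas lin_simps =
  linear_add[OF linear_act] linear_scale[OF linear_act]
  linear_diff[OF linear_act] linear_zero[OF linear_act]
  linear_add[OF linear_m_left] linear_scale[OF linear_m_left]
  linear_diff[OF linear_m_left] linear_zero[OF linear_m_left]
  linear_add[OF linear_m_right] linear_scale[OF linear_m_right]
  linear_diff[OF linear_m_right] linear_zero[OF linear_m_right]

definition val :: "(word \<Rightarrow>\<^sub>0 rat) \<Rightarrow> 'b" where
  "val = extend s wval"

lemma linear_val: "Vector_Spaces.linear qscale s val"
  unfolding val_def by (rule linear_extend) (fact vector_space_axioms)

lemmas val_simps =
  linear_add[OF linear_val] linear_scale[OF linear_val]
  linear_diff[OF linear_val] linear_zero[OF linear_val]

lemma val_basis [simp]: "val (basis w) = wval w"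
  by (simp add: val_def extend_basis vector_space_axioms)

lemma val_prefix: "val (prefix x p) = act x (val p)"
  by (induction p rule: free_induct) (simp_all add: val_simps prefix_linear_simps lin_simps)

text \<open>The recursion for two words starting with d is the Leibniz rule solved for a product of
  derivatives: Da Db = D(a Db) - a D(Db).\<close>

lemma val_wshuffle: "val (wshuffle u v) = m (wval u) (wval v)"
proof (induction u v rule: wshuffle.induct)
  case (5 u v)
  then show ?case
    by (simp add: val_simps val_prefix leibniz)
qed (simp_all add: val_prefix Y_left Y_right unit_left unit_right)

lemma val_shuffle: "val (shuffle p q) = m (val p) (val q)"
proof (induction p rule: free_induct)
  case (basis u)
  show ?case
    by (induction q rule: free_induct)
      (simp_all add: val_wshuffle val_simps shuffle_linear_simps lin_simps)
qed (simp_all add: val_simps shuffle_linear_simps lin_simps)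

text \<open>The kernel of \<open>val\<close> is an ideal by multiplicativity and contains the
  generators because D is a derivation.\<close>

lemma val_L_minus:
  assumes "p \<in> L_minus" shows "val p = 0"
proof -
  have "val ((prefix Ld ^^ k) (leibniz_defect (basis u) (basis v))) = 0" for k u v
    by (induction k)
      (simp_all add: val_prefix lin_simps leibniz_defect_def val_simps val_wshuffle leibniz
        linear_zero[OF linear_D])
  then have "L_minus_gens \<subseteq> {p. val p = 0}"
    unfolding L_minus_gens_defect by blast
  moreover have "shuffle_ideal {p. val p = 0}"
    by (simp add: shuffle_ideal_def qvs.subspace_def val_simps val_shuffle lin_simps)
  ultimately show ?thesis
    using L_minus_least assms by blast
qed

definition hval :: "H0 \<Rightarrow> 'b" where
  "hval h = val (rep_H0 h)"

text \<open>Two representatives differ by an element of \<open>S_minus\<close>, where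
  \<open>val\<close> vanishes.\<close>

lemma hval_abs: "hval (abs_H0 p) = val p"
proof -
  have "rep_H0 (abs_H0 p) - p \<in> S_minus"
    using Quotient3_rep_abs[OF Quotient3_H0, of p]
    by (simp add: qvs.subspace_0[OF subspace_S_minus])
  then show ?thesis
    using val_L_minus by (fastforce simp: hval_def S_minus_eq_L_minus val_simps)
qed

end

section \<open>The space \<open>\<H>\<^sub>0\<close> and its operations\<close>

lemma abs_H0_eq_0_iff: "abs_H0 p = 0 \<longleftrightarrow> p \<in> S_minus"
  by (simp add: zero_H0_def H0.abs_eq_iff)

interpretation hvs: vector_space hscale
  by standard (transfer; simp add: algebra_simps qvs.subspace_0[OF subspace_S_minus])+

lemma wclass_snoc_d: "wclass (w @ [Ld]) = 0"
  by (simp add: wclass_def abs_H0_eq_0_iff S_minus_eq_L_minus basis_snoc_d_L_minus)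

lemma H0_induct [case_names wclass add scale]:
  assumes "\<And>w. P (wclass w)" "\<And>g h. P g \<Longrightarrow> P h \<Longrightarrow> P (g + h)" "\<And>c h. P h \<Longrightarrow> P (hscale c h)"
  shows "P h"
proof (induction h rule: H0.abs_induct)
  case (1 p)
  show ?case
    by (induction p rule: free_induct)
      (use assms in \<open>simp_all add: wclass_def plus_H0.abs_eq[symmetric] hscale.abs_eq[symmetric]\<close>)
qed

lemma not_Y_wordE:
  assumes "w \<notin> Y_words"
  obtains v where "w = v @ [Ld]"
  using assms unfolding Y_words_def
  by (cases w rule: rev_cases) (auto, metis letter.exhaust)

text \<open>A word outside \<open>Y_words\<close> ends in d, so its class is zero and both maps
  vanish on it.\<close>

lemma linear_eq_on_Y_words:
  assumes "Vector_Spaces.linear hscale s f" "Vector_Spaces.linear hscale s g"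
    and "\<And>w. w \<in> Y_words \<Longrightarrow> f (wclass w) = g (wclass w)"
  shows "f = g"
proof
  fix h
  show "f h = g h"
  proof (induction h rule: H0_induct)
    case (wclass w)
    show ?case
    proof (cases "w \<in> Y_words")
      case False
      then obtain v where "w = v @ [Ld]"
        by (rule not_Y_wordE)
      then show ?thesis
        by (simp add: wclass_snoc_d linear_zero[OF assms(1)] linear_zero[OF assms(2)])
    qed (use assms in blast)
  qed (use assms in \<open>simp_all add: linear_add linear_scale\<close>)
qed

text \<open>Resolves the definite description: it is enough to exhibit one linear map with the
  prescribed values.\<close>

lemma linear_on_words_eq:
  assumes "Vector_Spaces.linear hscale s f" "\<And>w. w \<in> Y_words \<Longrightarrow> f (wclass w) = F w"
  shows "linear_on_words s F = f"
  unfolding linear_on_words_def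
  by (rule the_equality) (use assms in \<open>auto intro!: linear_eq_on_Y_words\<close>)

context differential_algebra
begin

lemma linear_hval: "Vector_Spaces.linear hscale s hval"
proof -
  have "hval (g + h) = hval g + hval h" for g h
    by (induction g rule: H0.abs_induct, induction h rule: H0.abs_induct)
      (simp add: plus_H0.abs_eq hval_abs val_simps)
  moreover have "hval (hscale c h) = s c (hval h)" for c h
    by (induction h rule: H0.abs_induct) (simp add: hscale.abs_eq hval_abs val_simps)
  ultimately show ?thesis
    by (simp add: Vector_Spaces.linear_iff hvs.vector_space_axioms vector_space_axioms)
qed

lemma hval_wclass [simp]: "hval (wclass w) = wval w"
  by (simp add: wclass_def hval_abs)

end

section \<open>Letters and product on the quotient\<close>

lift_definition hprefix :: "letter \<Rightarrow> H0 \<Rightarrow> H0" is prefix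
  using prefix_L_minus by (fastforce simp: S_minus_eq_L_minus prefix_linear_simps)

lift_definition hmult :: "H0 \<Rightarrow> H0 \<Rightarrow> H0" is shuffle
proof -
  fix p p' q q'
  assume "p - p' \<in> S_minus" "q - q' \<in> S_minus"
  then have "shuffle (p - p') q + shuffle p' (q - q') \<in> S_minus"
    using shuffle_ideal_L_minus subspace_S_minus
    by (auto simp: S_minus_eq_L_minus shuffle_ideal_def qvs.subspace_def)
  then show "shuffle p q - shuffle p' q' \<in> S_minus"
    by (simp add: shuffle_linear_simps)
qed

text \<open>The Leibniz rule fails on words, for instance for the product of the empty word with
  itself, but holds here because the defects lie in the ideal.\<close>

interpretation H0: differential_algebra hscale hmult "hprefix Ld" "hprefix Ly" "wclass []"
proof (rule differential_algebra.intro[OF hvs.vector_space_axioms], rule differential_algebra_axioms.intro)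
  show "Vector_Spaces.linear hscale hscale (\<lambda>a. hmult a b)" for b
    unfolding Vector_Spaces.linear_iff
    by (intro conjI allI hvs.vector_space_axioms; transfer)
      (simp_all add: shuffle_linear_simps qvs.subspace_0[OF subspace_S_minus])
  show "Vector_Spaces.linear hscale hscale (hmult a)" for a
    unfolding Vector_Spaces.linear_iff
    by (intro conjI allI hvs.vector_space_axioms; transfer)
      (simp_all add: shuffle_linear_simps qvs.subspace_0[OF subspace_S_minus])
  have linear_hprefix: "Vector_Spaces.linear hscale hscale (hprefix x)" for x
    unfolding Vector_Spaces.linear_iff
    by (intro conjI allI hvs.vector_space_axioms; transfer)
      (simp_all add: prefix_linear_simps qvs.subspace_0[OF subspace_S_minus])
  show "Vector_Spaces.linear hscale hscale (hprefix Ld)" "Vector_Spaces.linear hscale hscale (hprefix Ly)"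
    by (rule linear_hprefix)+
  show "hprefix Ld (hmult a b) = hmult (hprefix Ld a) b + hmult a (hprefix Ld b)" for a b
    by transfer (use leibniz_defect_L_minus in
        \<open>simp add: leibniz_defect_def S_minus_eq_L_minus diff_diff_eq\<close>)
  show "hmult (hprefix Ly a) b = hprefix Ly (hmult a b)" for a b
    by transfer (simp add: shuffle_prefix_y_left qvs.subspace_0[OF subspace_S_minus])
  show "hmult a (hprefix Ly b) = hprefix Ly (hmult a b)" for a b
    by transfer (simp add: shuffle_prefix_y_right qvs.subspace_0[OF subspace_S_minus])
  show "hmult (wclass []) a = a" for a
    unfolding wclass_def by transfer (simp add: qvs.subspace_0[OF subspace_S_minus])
  show "hmult a (wclass []) = a" for a
    unfolding wclass_def by transfer (simp add: qvs.subspace_0[OF subspace_S_minus])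
qed

lemma hprefix_wclass [simp]: "hprefix x (wclass w) = wclass (x # w)"
  by (simp add: wclass_def hprefix.abs_eq)

section \<open>The tensor product\<close>

interpretation hhvs: vector_space hhscale
  by standard (transfer; simp add: algebra_simps qvs.subspace_0[OF subspace_bilinear_rels])+

definition bilinear :: "(rat \<Rightarrow> 'b \<Rightarrow> 'b) \<Rightarrow> (H0 \<Rightarrow> H0 \<Rightarrow> 'b::ab_group_add) \<Rightarrow> bool" where
  "bilinear s B \<longleftrightarrow> (\<forall>a. Vector_Spaces.linear hscale s (B a)) \<and>
     (\<forall>b. Vector_Spaces.linear hscale s (\<lambda>a. B a b))"

lemma bilinear_tensor: "bilinear hhscale tensor"
proof -
  have rels: "x \<in> bilinear_rels" if
    "x \<in> {basis (a + a', b) - basis (a, b) - basis (a', b) | a a' b. True} \<union>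
      {basis (a, b + b') - basis (a, b) - basis (a, b') | a b b'. True} \<union>
      {basis (hscale c a, b) - qscale c (basis (a, b)) | c a b. True} \<union>
      {basis (a, hscale c b) - qscale c (basis (a, b)) | c a b. True}" for x
    unfolding bilinear_rels_def using that by (rule qvs.span_base)
  have "tensor (a + a') b = tensor a b + tensor a' b" for a a' b
    unfolding tensor_def plus_H0H0.abs_eq H0H0.abs_eq_iff diff_diff_eq[symmetric]
    by (rule rels) blast
  moreover have "tensor a (b + b') = tensor a b + tensor a b'" for a b b'
    unfolding tensor_def plus_H0H0.abs_eq H0H0.abs_eq_iff diff_diff_eq[symmetric]
    by (rule rels) blast
  moreover have "tensor (hscale c a) b = hhscale c (tensor a b)" for c a b
    unfolding tensor_def hhscale.abs_eq H0H0.abs_eq_iff by (rule rels) blast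
  moreover have "tensor a (hscale c b) = hhscale c (tensor a b)" for c a b
    unfolding tensor_def hhscale.abs_eq H0H0.abs_eq_iff by (rule rels) blast
  ultimately show ?thesis
    by (simp add: bilinear_def Vector_Spaces.linear_iff hvs.vector_space_axioms
        hhvs.vector_space_axioms)
qed

lemma bilinearD:
  assumes "bilinear s B"
  shows "Vector_Spaces.linear hscale s (B a)" "Vector_Spaces.linear hscale s (\<lambda>a. B a b)"
  using assms by (simp_all add: bilinear_def)

lemma bilinear_vector_space: "bilinear s B \<Longrightarrow> vector_space s"
  using bilinearD(1) linear_vector_space(2) by blast

lemma bilinear_simps:
  assumes "bilinear s B"
  shows "B (a + a') b = B a b + B a' b" "B a (b + b') = B a b + B a b'"
    "B (hscale c a) b = s c (B a b)" "B a (hscale c b) = s c (B a b)"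
    "B 0 b = 0" "B a 0 = 0"
  using linear_add[OF bilinearD(1)[OF assms]] linear_add[OF bilinearD(2)[OF assms]]
    linear_scale[OF bilinearD(1)[OF assms]] linear_scale[OF bilinearD(2)[OF assms]]
    linear_zero[OF bilinearD(1)[OF assms]] linear_zero[OF bilinearD(2)[OF assms]]
  by simp_all

lemma bilinearI:
  assumes "vector_space s"
    and "\<And>a a' b. B (a + a') b = B a b + B a' b" "\<And>a b b'. B a (b + b') = B a b + B a b'"
    and "\<And>c a b. B (hscale c a) b = s c (B a b)" "\<And>c a b. B a (hscale c b) = s c (B a b)"
  shows "bilinear s B"
  using assms by (simp add: bilinear_def Vector_Spaces.linear_iff hvs.vector_space_axioms)

lemmas tensor_simps = bilinear_simps[OF bilinear_tensor]

text \<open>Pure tensors and sums suffice because a scalar can be absorbed into the left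
  factor.\<close>

lemma H0H0_induct [case_names tensor add]:
  assumes "\<And>a b. P (tensor a b)" "\<And>s t. P s \<Longrightarrow> P t \<Longrightarrow> P (s + t)"
  shows "P t"
proof -
  \<comment> \<open>Quantifying over all multiples makes the scaling case of the inner induction
    immediate.\<close>
  have "\<forall>c. P (abs_H0H0 (qscale c p))" for p
  proof (induction p rule: free_induct)
    case (basis x)
    have "abs_H0H0 (qscale c (basis x)) = tensor (hscale c (fst x)) (snd x)" for c
      by (simp add: tensor_simps) (simp add: tensor_def hhscale.abs_eq)
    then show ?case
      by (simp add: assms(1))
  next
    case (add p q)
    then show ?case
      by (simp add: qvs.scale_right_distrib plus_H0H0.abs_eq[symmetric] assms(2))
  qed simp
  from this[THEN spec, of 1] show ?thesis
    by (induction t rule: H0H0.abs_induct) simp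
qed

lemma linear_eq_on_tensors:
  assumes "Vector_Spaces.linear hhscale s f" "Vector_Spaces.linear hhscale s g"
    and "\<And>a b. f (tensor a b) = g (tensor a b)"
  shows "f = g"
proof
  show "f t = g t" for t
    by (induction t rule: H0H0_induct) (use assms in \<open>simp_all add: linear_add\<close>)
qed

text \<open>The linear map that the universal property of the tensor product assigns to a bilinear
  map, computed on a representative.\<close>

definition tlift :: "(rat \<Rightarrow> 'b \<Rightarrow> 'b) \<Rightarrow> (H0 \<Rightarrow> H0 \<Rightarrow> 'b::ab_group_add) \<Rightarrow> H0H0 \<Rightarrow> 'b" where
  "tlift s B t = extend s (case_prod B) (rep_H0H0 t)"

text \<open>Bilinearity makes the extension to the free space vanish on the relations, so the
  representative does not matter.\<close>

lemma tlift_abs: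
  assumes "bilinear s B"
  shows "tlift s B (abs_H0H0 p) = extend s (case_prod B) p"
proof -
  let ?E = "extend s (case_prod B)"
  note vs = bilinear_vector_space[OF assms]
  note lin = linear_extend[OF vs, of "case_prod B"]
  have "qvs.subspace {p. ?E p = 0}"
    using vs by (simp add: qvs.subspace_def linear_add[OF lin] linear_scale[OF lin]
        linear_zero[OF lin] module.scale_zero_right module_iff_vector_space)
  then have "bilinear_rels \<subseteq> {p. ?E p = 0}"
    unfolding bilinear_rels_def
    by (intro qvs.span_minimal)
      (auto simp: linear_diff[OF lin] linear_scale[OF lin] extend_basis[OF vs]
        bilinear_simps[OF assms])
  moreover have "rep_H0H0 (abs_H0H0 p) - p \<in> bilinear_rels"
    using Quotient3_rep_abs[OF Quotient3_H0H0, of p]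
    by (simp add: qvs.subspace_0[OF subspace_bilinear_rels])
  ultimately show ?thesis
    by (fastforce simp: tlift_def linear_diff[OF lin])
qed

lemma tlift_tensor [simp]: "bilinear s B \<Longrightarrow> tlift s B (tensor a b) = B a b"
  by (simp add: tensor_def tlift_abs extend_basis bilinear_vector_space)

lemma linear_tlift:
  assumes "bilinear s B"
  shows "Vector_Spaces.linear hhscale s (tlift s B)"
proof -
  note vs = bilinear_vector_space[OF assms]
  note lin = linear_extend[OF vs, of "case_prod B"]
  have "tlift s B (t + t') = tlift s B t + tlift s B t'" for t t'
    by (induction t rule: H0H0.abs_induct, induction t' rule: H0H0.abs_induct)
      (simp add: plus_H0H0.abs_eq tlift_abs[OF assms] linear_add[OF lin])
  moreover have "tlift s B (hhscale c t) = s c (tlift s B t)" for c t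
    by (induction t rule: H0H0.abs_induct)
      (simp add: hhscale.abs_eq tlift_abs[OF assms] linear_scale[OF lin])
  ultimately show ?thesis
    by (simp add: Vector_Spaces.linear_iff hhvs.vector_space_axioms vs)
qed

section \<open>The coproduct\<close>

lemma wclass_not_Y: "w \<notin> Y_words \<Longrightarrow> wclass w = 0"
  by (metis not_Y_wordE wclass_snoc_d)

text \<open>The operator x \<otimes> 1 + 1 \<otimes> x: for d the derivation of the tensor square,
  for y multiplication by y \<otimes> 1 + 1 \<otimes> y.\<close>

definition hhprefix :: "letter \<Rightarrow> H0H0 \<Rightarrow> H0H0" where
  "hhprefix x = tlift hhscale (\<lambda>a b. tensor (hprefix x a) b + tensor a (hprefix x b))"

lemma linear_hprefix: "Vector_Spaces.linear hscale hscale (hprefix x)"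
  using H0.linear_D H0.linear_Y by (cases x) simp_all

lemmas hprefix_simps = linear_add[OF linear_hprefix] linear_scale[OF linear_hprefix]

lemmas hmult_simps =
  linear_add[OF H0.linear_m_left] linear_scale[OF H0.linear_m_left]
  linear_add[OF H0.linear_m_right] linear_scale[OF H0.linear_m_right]

lemma bilinear_hhprefix:
  "bilinear hhscale (\<lambda>a b. tensor (hprefix x a) b + tensor a (hprefix x b))"
  by (rule bilinearI[OF hhvs.vector_space_axioms])
    (simp_all add: tensor_simps hprefix_simps hhvs.scale_right_distrib algebra_simps)

lemma hhprefix_tensor [simp]:
  "hhprefix x (tensor a b) = tensor (hprefix x a) b + tensor a (hprefix x b)"
  by (simp add: hhprefix_def bilinear_hhprefix)

lemma linear_hhprefix: "Vector_Spaces.linear hhscale hhscale (hhprefix x)"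
  unfolding hhprefix_def by (rule linear_tlift[OF bilinear_hhprefix])

text \<open>Right multiplication by c \<otimes> d. The product on \<open>H0H0\<close> comes from
  applying the universal property once for each factor.\<close>

definition hhmult1 :: "H0 \<Rightarrow> H0 \<Rightarrow> H0H0 \<Rightarrow> H0H0" where
  "hhmult1 c d = tlift hhscale (\<lambda>a b. tensor (hmult a c) (hmult b d))"

definition hhmult :: "H0H0 \<Rightarrow> H0H0 \<Rightarrow> H0H0" where
  "hhmult t = tlift hhscale (\<lambda>c d. hhmult1 c d t)"

lemma bilinear_hmult_tensor: "bilinear hhscale (\<lambda>a b. tensor (hmult a c) (hmult b d))"
  by (rule bilinearI[OF hhvs.vector_space_axioms]) (simp_all add: tensor_simps hmult_simps)

lemma linear_hhmult1: "Vector_Spaces.linear hhscale hhscale (hhmult1 c d)"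
  unfolding hhmult1_def by (rule linear_tlift[OF bilinear_hmult_tensor])

lemma hhmult1_tensor [simp]: "hhmult1 c d (tensor a b) = tensor (hmult a c) (hmult b d)"
  by (simp add: hhmult1_def tlift_tensor[OF bilinear_hmult_tensor])

lemma bilinear_hhmult1: "bilinear hhscale (\<lambda>c d. hhmult1 c d t)"
  by (rule bilinearI[OF hhvs.vector_space_axioms]; induction t rule: H0H0_induct)
    (simp_all add: tensor_simps hmult_simps hhvs.scale_right_distrib linear_add[OF linear_hhmult1])

lemma hhmult_tensor_right [simp]: "hhmult t (tensor c d) = hhmult1 c d t"
  by (simp add: hhmult_def tlift_tensor[OF bilinear_hhmult1])

lemma linear_hhmult_right: "Vector_Spaces.linear hhscale hhscale (hhmult t)"
  unfolding hhmult_def by (rule linear_tlift[OF bilinear_hhmult1])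

lemma linear_hhmult_left: "Vector_Spaces.linear hhscale hhscale (\<lambda>t. hhmult t u)"
proof -
  have "hhmult (t + t') u = hhmult t u + hhmult t' u" for t t'
    by (induction u rule: H0H0_induct)
      (simp_all add: linear_add[OF linear_hhmult1] linear_add[OF linear_hhmult_right])
  moreover have "hhmult (hhscale c t) u = hhscale c (hhmult t u)" for c t
    by (induction u rule: H0H0_induct)
      (simp_all add: linear_scale[OF linear_hhmult1] linear_add[OF linear_hhmult_right]
        hhvs.scale_right_distrib)
  ultimately show ?thesis
    by (simp add: Vector_Spaces.linear_iff hhvs.vector_space_axioms)
qed

lemmas hhprefix_add = linear_add[OF linear_hhprefix]

lemmas hhmult_add =
  linear_add[OF linear_hhmult1] linear_add[OF linear_hhmult_left] linear_add[OF linear_hhmult_right]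

interpretation H0H0: differential_algebra hhscale hhmult "hhprefix Ld" "hhprefix Ly"
  "tensor (wclass []) (wclass [])"
proof (rule differential_algebra.intro[OF hhvs.vector_space_axioms],
    rule differential_algebra_axioms.intro)
  show "hhprefix Ld (hhmult t u) = hhmult (hhprefix Ld t) u + hhmult t (hhprefix Ld u)" for t u
  proof (induction t rule: H0H0_induct)
    case (tensor a b)
    show ?case
      by (induction u rule: H0H0_induct)
        (simp_all add: hhprefix_add hhmult_add H0.leibniz tensor_simps algebra_simps)
  qed (simp add: hhprefix_add hhmult_add algebra_simps)
  show "hhmult (hhprefix Ly t) u = hhprefix Ly (hhmult t u)" for t u
  proof (induction t rule: H0H0_induct)
    case (tensor a b)
    show ?case
      by (induction u rule: H0H0_induct)
        (simp_all add: hhprefix_add hhmult_add H0.Y_left tensor_simps algebra_simps)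
  qed (simp add: hhprefix_add hhmult_add algebra_simps)
  show "hhmult t (hhprefix Ly u) = hhprefix Ly (hhmult t u)" for t u
  proof (induction t rule: H0H0_induct)
    case (tensor a b)
    show ?case
      by (induction u rule: H0H0_induct)
        (simp_all add: hhprefix_add hhmult_add H0.Y_right tensor_simps algebra_simps)
  qed (simp add: hhprefix_add hhmult_add algebra_simps)
  show "hhmult (tensor (wclass []) (wclass [])) t = t" for t
    by (induction t rule: H0H0_induct) (simp_all add: H0.unit_left hhmult_add)
  show "hhmult t (tensor (wclass []) (wclass [])) = t" for t
    by (induction t rule: H0H0_induct) (simp_all add: H0.unit_right hhmult_add)
qed (rule linear_hhprefix linear_hhmult_left linear_hhmult_right)+

text \<open>Subsets of positions are sorted by whether they contain 0, the other positions being
  shifted by \<open>Suc\<close>; accordingly x goes to the left or to the right subword.\<close>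

lemma sum_splittings_Cons:
  fixes G :: "'a list \<Rightarrow> 'a list \<Rightarrow> 'b::comm_monoid_add"
  shows "(\<Sum>S\<in>Pow {..<length (x # w)}. G (nths (x # w) S) (nths (x # w) ({..<length (x # w)} - S))) =
    (\<Sum>S\<in>Pow {..<length w}. G (x # nths w S) (nths w ({..<length w} - S)) +
       G (nths w S) (x # nths w ({..<length w} - S)))"
proof -
  let ?A = "Pow {..<length w}" and ?N = "{..<length (x # w)}"
  let ?t = "\<lambda>S. G (nths (x # w) S) (nths (x # w) (?N - S))"
  have Pow: "Pow ?N = (\<lambda>S. insert 0 (Suc ` S)) ` ?A \<union> (`) Suc ` ?A"
    by (simp add: lessThan_Suc_eq_insert_0 Pow_insert image_Pow_surj[OF refl, symmetric] image_image
        Un_commute)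
  have inj: "inj_on ((`) Suc) ?A" "inj_on (\<lambda>S. insert 0 (Suc ` S)) ?A"
    by (auto simp: inj_on_def)
  have in_Suc: "{j. Suc j \<in> Suc ` S} = S" "{j. Suc j \<in> insert 0 (Suc ` S)} = S"
    "{j. Suc j < Suc n \<and> Suc j \<notin> Suc ` S} = {..<n} - S" for S n
    by auto
  have "sum ?t (Pow ?N) = sum ?t ((\<lambda>S. insert 0 (Suc ` S)) ` ?A) + sum ?t ((`) Suc ` ?A)"
    unfolding Pow by (rule sum.union_disjoint) auto
  also have "sum ?t ((\<lambda>S. insert 0 (Suc ` S)) ` ?A) =
      (\<Sum>S\<in>?A. G (x # nths w S) (nths w ({..<length w} - S)))"
    unfolding sum.reindex[OF inj(2)] by (rule sum.cong[OF refl])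
      (auto simp: nths_Cons in_Suc intro!: arg_cong2[of _ _ _ _ G] arg_cong[of _ _ "nths w"])
  also have "sum ?t ((`) Suc ` ?A) =
      (\<Sum>S\<in>?A. G (nths w S) (x # nths w ({..<length w} - S)))"
    unfolding sum.reindex[OF inj(1)] by (rule sum.cong[OF refl])
      (auto simp: nths_Cons in_Suc intro!: arg_cong2[of _ _ _ _ G] arg_cong[of _ _ "nths w"])
  finally show ?thesis
    by (simp add: sum.distrib)
qed

text \<open>Expanding a composition of operators x \<otimes> 1 + 1 \<otimes> x distributes the
  letters over the two factors in all possible ways.\<close>

lemma wval_H0H0: "H0H0.wval w = (\<Sum>S\<in>Pow {..<length w}.
   tensor (wclass (nths w S)) (wclass (nths w ({..<length w} - S))))"
proof (induction w)
  case (Cons x w)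
  have "H0H0.wval (x # w) = hhprefix x (H0H0.wval w)"
    by (cases x) simp_all
  then show ?case
    unfolding Cons sum_splittings_Cons[of "\<lambda>u v. tensor (wclass u) (wclass v)"]
    by (simp add: linear_sum[OF linear_hhprefix])
qed simp

lemma coproduct_eq: "coproduct = H0H0.hval"
  unfolding coproduct_def
proof (rule linear_on_words_eq[OF H0H0.linear_hval])
  \<comment> \<open>The definition admits only splittings into two words of \<open>Y_words\<close>;
    every other splitting gives a zero tensor, so the two sums agree.\<close>
  have "tensor (wclass u) (wclass v) = 0" if "\<not> (u \<in> Y_words \<and> v \<in> Y_words)" for u v
    using that by (auto simp: wclass_not_Y tensor_simps)
  then show "H0H0.hval (wclass w) =
    (\<Sum>S \<in> {S. S \<subseteq> {..<length w} \<and> nths w S \<in> Y_words \<and> nths w ({..<length w} - S) \<in> Y_words}.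
       tensor (wclass (nths w S)) (wclass (nths w ({..<length w} - S))))" for w
    unfolding H0H0.hval_wclass wval_H0H0
    by (intro sum.mono_neutral_right) auto
qed

section \<open>The counit\<close>

interpretation rat_vs: vector_space "(*) :: rat \<Rightarrow> rat \<Rightarrow> rat"
  by standard (simp_all add: algebra_simps)

text \<open>With both letters acting as zero on the rationals, evaluation sees only the empty word.
  This realises the counit as a linear map.\<close>

interpretation trivial: differential_algebra "(*)" "(*)" "\<lambda>_. 0" "\<lambda>_. 0" "1 :: rat"
  by (rule differential_algebra.intro[OF rat_vs.vector_space_axioms],
      rule differential_algebra_axioms.intro, unfold Vector_Spaces.linear_iff)
    (simp_all add: rat_vs.vector_space_axioms distrib_left distrib_right)

lemma wval_trivial: "trivial.wval w = (if w = [] then 1 else 0)"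
proof -
  have "trivial.act x r = 0" for x r
    by (cases x) simp_all
  then show ?thesis
    by (cases w) simp_all
qed

lemma counit_eq: "counit = trivial.hval"
  unfolding counit_def
  by (rule linear_on_words_eq[OF trivial.linear_hval]) (simp add: wval_trivial)

lemma counit_wclass: "counit (wclass w) = (if w = [] then 1 else 0)"
  by (simp add: counit_eq wval_trivial)

section \<open>Convolution\<close>

interpretation avs: vector_space ascale
proof
  fix c d :: rat and f g :: "rat fls"
  show "ascale c (ascale d f) = ascale (c * d) f"
    unfolding ascale_def mult.assoc[symmetric] fls_const_mult_const ..
  show "ascale (c + d) f = ascale c f + ascale d f"
    unfolding ascale_def distrib_right[symmetric] fls_plus_const ..
qed (simp_all add: ascale_def distrib_left)

lemma differential_algebra_fls:
  "differential_algebra ascale (*) fls_deriv ((*) \<eta>) (1 :: rat fls)"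
proof (rule differential_algebra.intro[OF avs.vector_space_axioms],
      rule differential_algebra_axioms.intro)
  have *: "fls_deriv (ascale c f) = ascale c (fls_deriv f)" for c f
    unfolding ascale_def by (rule fls_deriv_mult_const_left)
  show "Vector_Spaces.linear ascale ascale (fls_deriv :: rat fls \<Rightarrow> _)"
    unfolding Vector_Spaces.linear_iff by (simp add: avs.vector_space_axioms *)
  show l: "Vector_Spaces.linear ascale ascale ((*) f)" for f
    unfolding Vector_Spaces.linear_iff
    by (simp add: avs.vector_space_axioms distrib_left) (simp add: ascale_def mult.left_commute)
  then show "Vector_Spaces.linear ascale ascale ((*) \<eta>)"
    .
  show "Vector_Spaces.linear ascale ascale (\<lambda>f. f * g)" for g
    using l[of g] by (simp add: mult.commute[of _ g])
  show "fls_deriv (f * g) = fls_deriv f * g + f * fls_deriv g" for f g :: "rat fls"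
    by simp
qed (simp_all add: mult.assoc mult.left_commute)

interpretation chr: differential_algebra ascale "(*)" fls_deriv "(*) \<eta>" "1 :: rat fls" for \<eta>
  by (rule differential_algebra_fls)

text \<open>The shuffle product of noncommutative power series, defined through its left derivatives.\<close>

primrec wconv :: "('x list \<Rightarrow> 'a) \<Rightarrow> ('x list \<Rightarrow> 'a) \<Rightarrow> 'x list \<Rightarrow> 'a::comm_ring_1" where
  "wconv f g [] = f [] * g []"
| "wconv f g (x # w) = wconv (\<lambda>v. f (x # v)) g w + wconv f (\<lambda>v. g (x # v)) w"

lemma wconv_add_left: "wconv (\<lambda>v. f v + f' v) g w = wconv f g w + wconv f' g w"
  by (induction w arbitrary: f f' g) (simp_all add: algebra_simps)

lemma wconv_mult_left: "wconv (\<lambda>v. c * f v) g w = c * wconv f g w"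
  by (induction w arbitrary: f g) (simp_all add: algebra_simps)

lemma wconv_commute: "wconv f g w = wconv g f w"
  by (induction w arbitrary: f g) (simp_all add: mult.commute add.commute)

lemma wconv_add_right: "wconv f (\<lambda>v. g v + g' v) w = wconv f g w + wconv f g' w"
  by (simp only: wconv_commute[of f] wconv_add_left)

lemma wconv_mult_right: "wconv f (\<lambda>v. c * g v) w = c * wconv f g w"
  by (simp only: wconv_commute[of f] wconv_mult_left)

lemma wconv_diff_left: "wconv (\<lambda>v. f v - f' v) g w = wconv f g w - wconv f' g w"
  using wconv_add_left[of f "\<lambda>v. (-1) * f' v" g w]
  unfolding wconv_mult_left by simp

lemma wconv_zero_left: "wconv (\<lambda>_. 0) g w = 0"
  using wconv_diff_left[of "\<lambda>_. 0" "\<lambda>_. 0" g w] by simp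

lemma wconv_sum_left: "wconv (\<lambda>v. \<Sum>i\<in>I. f i v) g w = (\<Sum>i\<in>I. wconv (f i) g w)"
  by (induction I rule: infinite_finite_induct) (simp_all add: wconv_add_left wconv_zero_left)

lemma wconv_assoc: "wconv (wconv f g) h w = wconv f (wconv g h) w"
  by (induction w arbitrary: f g h)
    (simp_all add: wconv_add_left wconv_add_right mult.assoc add.assoc)

text \<open>Lower bounds for the lowest degree add under the product.\<close>

lemma wconv_vanish:
  assumes "\<And>v. length v < p \<Longrightarrow> f v = 0" "\<And>v. length v < q \<Longrightarrow> g v = 0" "length w < p + q"
  shows "wconv f g w = 0"
  using assms
proof (induction w arbitrary: f g p q)
  case Nil
  then have "0 < p \<or> 0 < q"
    by auto
  then show ?case
    using Nil.prems(1)[of "[]"] Nil.prems(2)[of "[]"] by auto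
next
  case (Cons x w)
  have "wconv (\<lambda>v. f (x # v)) g w = 0"
    using Cons.prems by (intro Cons.IH[of "p - 1" _ q]) auto
  moreover have "wconv f (\<lambda>v. g (x # v)) w = 0"
    using Cons.prems by (intro Cons.IH[of p _ "q - 1"]) auto
  ultimately show ?case
    by simp
qed

text \<open>In every other term f is evaluated at a proper subword of w.\<close>

lemma wconv_lead:
  assumes "\<And>v. length v < length w \<Longrightarrow> f v = 0"
  shows "wconv f g w = f w * g []"
  using assms
proof (induction w arbitrary: f g)
  case (Cons x w)
  have "wconv f (\<lambda>v. g (x # v)) w = 0"
    using Cons.prems by (intro wconv_vanish[of "length (x # w)" _ 0]) auto
  moreover have "wconv (\<lambda>v. f (x # v)) g w = f (x # w) * g []"
    using Cons.prems by (intro Cons.IH) auto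
  ultimately show ?case
    by simp
qed simp

lemma wconv_unit: "wconv (\<lambda>v. if v = [] then 1 else 0) g w = g w"
  by (induction w arbitrary: g) (simp_all add: wconv_zero_left)

text \<open>Only subwords of w enter.\<close>

lemma wconv_cong:
  assumes "\<And>v. length v \<le> length w \<Longrightarrow> f v = f' v"
  shows "wconv f g w = wconv f' g w"
proof -
  have "wconv (\<lambda>v. f v - f' v) g w = 0"
    using assms by (intro wconv_vanish[of "Suc (length w)" _ 0]) (auto simp: less_Suc_eq_le)
  then show ?thesis
    by (simp add: wconv_diff_left)
qed

section \<open>Convolution on classes of words\<close>

lemma bilinear_mult:
  assumes "linear_HA \<alpha>" "linear_HA \<beta>"
  shows "bilinear ascale (\<lambda>a b. \<alpha> a * \<beta> b)"
proof (rule bilinearI[OF avs.vector_space_axioms])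
  show "\<alpha> (hscale c a) * \<beta> b = ascale c (\<alpha> a * \<beta> b)"
    "\<alpha> a * \<beta> (hscale c b) = ascale c (\<alpha> a * \<beta> b)" for c a b
    unfolding linear_scale[OF assms(1)] linear_scale[OF assms(2)] ascale_def
    by (simp_all only: mult.assoc mult.left_commute)
qed (simp_all add: linear_add[OF assms(1)] linear_add[OF assms(2)] distrib_left distrib_right)

lemma mult_tensor_eq:
  assumes "linear_HA \<alpha>" "linear_HA \<beta>"
  shows "mult_tensor \<alpha> \<beta> = tlift ascale (\<lambda>a b. \<alpha> a * \<beta> b)"
  unfolding mult_tensor_def
proof (rule the_equality)
  note lin = linear_tlift[OF bilinear_mult[OF assms]]
  note ten = tlift_tensor[OF bilinear_mult[OF assms]]
  show "Vector_Spaces.linear hhscale ascale (tlift ascale (\<lambda>a b. \<alpha> a * \<beta> b)) \<and>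
    (\<forall>a b. tlift ascale (\<lambda>a b. \<alpha> a * \<beta> b) (tensor a b) = \<alpha> a * \<beta> b)"
    by (simp add: lin ten)
  show "f = tlift ascale (\<lambda>a b. \<alpha> a * \<beta> b)"
    if "Vector_Spaces.linear hhscale ascale f \<and> (\<forall>a b. f (tensor a b) = \<alpha> a * \<beta> b)" for f
    using that by (intro linear_eq_on_tensors[OF _ lin]) (simp_all add: ten)
qed

lemma mult_tensor_tensor:
  "linear_HA \<alpha> \<Longrightarrow> linear_HA \<beta> \<Longrightarrow> mult_tensor \<alpha> \<beta> (tensor a b) = \<alpha> a * \<beta> b"
  by (simp add: mult_tensor_eq tlift_tensor[OF bilinear_mult])

lemma linear_mult_tensor:
  "linear_HA \<alpha> \<Longrightarrow> linear_HA \<beta> \<Longrightarrow> Vector_Spaces.linear hhscale ascale (mult_tensor \<alpha> \<beta>)"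
  by (simp add: mult_tensor_eq linear_tlift[OF bilinear_mult])

lemma linear_conv:
  assumes "linear_HA \<alpha>" "linear_HA \<beta>"
  shows "linear_HA (conv \<alpha> \<beta>)"
  unfolding conv_def coproduct_eq
  by (rule Vector_Spaces.linear_compose[OF H0H0.linear_hval linear_mult_tensor[OF assms]])

lemma linear_HA_hprefix:
  assumes "linear_HA \<alpha>"
  shows "linear_HA (\<lambda>a. \<alpha> (hprefix x a))"
  using Vector_Spaces.linear_compose[OF linear_hprefix assms] by (simp add: o_def)

text \<open>Transposing x \<otimes> 1 + 1 \<otimes> x onto the functionals yields the recursion of
  \<open>wconv\<close>.\<close>

lemma mult_tensor_hhprefix:
  assumes "linear_HA \<alpha>" "linear_HA \<beta>"
  shows "mult_tensor \<alpha> \<beta> (hhprefix x t) =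
    mult_tensor (\<lambda>a. \<alpha> (hprefix x a)) \<beta> t + mult_tensor \<alpha> (\<lambda>a. \<beta> (hprefix x a)) t"
proof -
  note add = linear_add[OF linear_mult_tensor]
  show ?thesis
    by (induction t rule: H0H0_induct)
      (simp_all add: hhprefix_add add assms linear_HA_hprefix mult_tensor_tensor)
qed

text \<open>Identities for \<open>conv\<close> become identities for \<open>wconv\<close>. The
  induction generalises over both functionals, as each letter is absorbed into one of them.\<close>

lemma conv_wclass:
  assumes "linear_HA \<alpha>" "linear_HA \<beta>"
  shows "conv \<alpha> \<beta> (wclass w) = wconv (\<lambda>v. \<alpha> (wclass v)) (\<lambda>v. \<beta> (wclass v)) w"
proof -
  have "mult_tensor \<alpha> \<beta> (H0H0.wval w) = wconv (\<lambda>v. \<alpha> (wclass v)) (\<lambda>v. \<beta> (wclass v)) w"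
    using assms
  proof (induction w arbitrary: \<alpha> \<beta>)
    case (Cons x w)
    have "H0H0.wval (x # w) = hhprefix x (H0H0.wval w)"
      by (cases x) simp_all
    moreover note Cons.IH[OF linear_HA_hprefix[of _ x]] Cons.IH[OF _ linear_HA_hprefix[of _ x]]
    ultimately show ?case
      by (simp only: mult_tensor_hhprefix Cons.prems wconv.simps hprefix_wclass)
  qed (simp add: mult_tensor_tensor)
  then show ?thesis
    by (simp add: conv_def coproduct_eq)
qed

section \<open>Group laws of convolution\<close>

lemma linear_HA_eqI:
  assumes "linear_HA f" "linear_HA g" "\<And>w. f (wclass w) = g (wclass w)"
  shows "f = g"
  using linear_eq_on_Y_words assms by blast

lemma conv_unit_wclass: "conv_unit (wclass w) = (if w = [] then 1 else 0)"
  by (simp add: conv_unit_def counit_wclass)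

lemma linear_conv_unit: "linear_HA conv_unit"
  using linear_add[OF trivial.linear_hval] linear_scale[OF trivial.linear_hval]
  by (simp add: Vector_Spaces.linear_iff hvs.vector_space_axioms avs.vector_space_axioms
      conv_unit_def counit_eq ascale_def fls_plus_const)

lemma conv_assoc:
  assumes "linear_HA \<alpha>" "linear_HA \<beta>" "linear_HA \<gamma>"
  shows "conv (conv \<alpha> \<beta>) \<gamma> = conv \<alpha> (conv \<beta> \<gamma>)"
  by (rule linear_HA_eqI) (simp_all add: assms linear_conv conv_wclass wconv_assoc)

lemma conv_commute:
  assumes "linear_HA \<alpha>" "linear_HA \<beta>"
  shows "conv \<alpha> \<beta> = conv \<beta> \<alpha>"
  by (rule linear_HA_eqI) (simp_all add: assms linear_conv conv_wclass wconv_commute)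

lemma conv_unit_left:
  assumes "linear_HA \<alpha>"
  shows "conv conv_unit \<alpha> = \<alpha>"
  by (rule linear_HA_eqI)
    (simp_all add: assms linear_conv linear_conv_unit conv_wclass conv_unit_wclass wconv_unit)

lemma conv_left_inverse_unique:
  assumes "linear_HA \<alpha>" "linear_HA \<beta>" "linear_HA \<beta>'"
    and "conv \<beta> \<alpha> = conv_unit" "conv \<alpha> \<beta>' = conv_unit"
  shows "\<beta> = \<beta>'"
proof -
  have "\<beta> = conv \<beta> (conv \<alpha> \<beta>')"
    \<comment> \<open>Commutativity moves the unit to the left of \<open>\<beta>\<close>.\<close>
    by (simp add: assms conv_commute[of \<beta>] linear_conv_unit conv_unit_left)
  also have "\<dots> = conv (conv \<beta> \<alpha>) \<beta>'"
    by (simp only: assms(1-3) conv_assoc)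
  also have "\<dots> = \<beta>'"
    by (simp add: assms conv_unit_left)
  finally show ?thesis .
qed

lemma linear_HA_diff:
  assumes "linear_HA \<alpha>" "linear_HA \<beta>"
  shows "linear_HA (\<lambda>h. \<alpha> h - \<beta> h)"
  using assms by (simp add: Vector_Spaces.linear_iff avs.scale_right_diff_distrib)

section \<open>Convolution inverses\<close>

primrec conv_pow :: "(H0 \<Rightarrow> rat fls) \<Rightarrow> nat \<Rightarrow> H0 \<Rightarrow> rat fls" where
  "conv_pow \<nu> 0 = conv_unit"
| "conv_pow \<nu> (Suc n) = conv \<nu> (conv_pow \<nu> n)"

lemma linear_conv_pow: "linear_HA \<nu> \<Longrightarrow> linear_HA (conv_pow \<nu> n)"
  by (induction n) (simp_all add: linear_conv_unit linear_conv)

text \<open>Vanishing at the empty word means lowest degree at least 1, and lowest degrees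
  add.\<close>

lemma conv_pow_wclass_eq_0:
  assumes "linear_HA \<nu>" "\<nu> (wclass []) = 0" "length w < n"
  shows "conv_pow \<nu> n (wclass w) = 0"
  using assms(3)
proof (induction n arbitrary: w)
  case (Suc n)
  then show ?case
    using assms(1,2)
    by (simp add: conv_wclass linear_conv_pow) (rule wconv_vanish[of 1 _ n]; simp)
qed simp

lemma conv_pow_locally_finite:
  assumes "linear_HA \<nu>" "\<nu> (wclass []) = 0"
  shows "\<exists>N. \<forall>n\<ge>N. conv_pow \<nu> n h = 0"
proof (induction h rule: H0_induct)
  case (wclass w)
  then show ?case
    using conv_pow_wclass_eq_0[OF assms] by (intro exI[of _ "Suc (length w)"]) simp
next
  case (add g h)
  then obtain M N where "\<forall>n\<ge>M. conv_pow \<nu> n g = 0" "\<forall>n\<ge>N. conv_pow \<nu> n h = 0"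
    by blast
  then show ?case
    by (intro exI[of _ "max M N"]) (simp add: linear_add[OF linear_conv_pow[OF assms(1)]])
qed (auto simp: linear_scale[OF linear_conv_pow[OF assms(1)]])

text \<open>The Neumann series for the inverse of \<epsilon> - \<nu>. It is finite at each h, with a
  cut-off depending on h.\<close>

definition conv_geometric :: "(H0 \<Rightarrow> rat fls) \<Rightarrow> H0 \<Rightarrow> rat fls" where
  "conv_geometric \<nu> h = (\<Sum>n < (LEAST N. \<forall>n\<ge>N. conv_pow \<nu> n h = 0). conv_pow \<nu> n h)"

text \<open>Any admissible cut-off gives the same sum, so several arguments can share one.\<close>

lemma conv_geometric_eq:
  assumes "\<forall>n\<ge>N. conv_pow \<nu> n h = 0"
  shows "conv_geometric \<nu> h = (\<Sum>n<N. conv_pow \<nu> n h)"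
proof -
  define L where "L = (LEAST N. \<forall>n\<ge>N. conv_pow \<nu> n h = 0)"
  have "\<forall>n\<ge>L. conv_pow \<nu> n h = 0"
    unfolding L_def using assms by (rule LeastI)
  moreover have "L \<le> N"
    unfolding L_def using assms by (rule Least_le)
  ultimately have "(\<Sum>n<L. conv_pow \<nu> n h) = (\<Sum>n<N. conv_pow \<nu> n h)"
    by (intro sum.mono_neutral_left) (auto simp: not_less)
  then show ?thesis
    by (simp add: conv_geometric_def L_def)
qed

lemma linear_conv_geometric:
  assumes "linear_HA \<nu>" "\<nu> (wclass []) = 0"
  shows "linear_HA (conv_geometric \<nu>)"
proof -
  note lin = linear_conv_pow[OF assms(1)]
  have "conv_geometric \<nu> (g + h) = conv_geometric \<nu> g + conv_geometric \<nu> h" for g h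
  proof -
    obtain M N where "\<forall>n\<ge>M. conv_pow \<nu> n g = 0" "\<forall>n\<ge>N. conv_pow \<nu> n h = 0"
      using conv_pow_locally_finite[OF assms] by metis
    then show ?thesis
      by (simp add: conv_geometric_eq[of "max M N"] linear_add[OF lin] sum.distrib)
  qed
  moreover have "conv_geometric \<nu> (hscale c h) = ascale c (conv_geometric \<nu> h)" for c h
  proof -
    obtain N where "\<forall>n\<ge>N. conv_pow \<nu> n h = 0"
      using conv_pow_locally_finite[OF assms] by metis
    then show ?thesis
      by (simp add: conv_geometric_eq[of N] linear_scale[OF lin] avs.scale_sum_right)
  qed
  ultimately show ?thesis
    by (simp add: Vector_Spaces.linear_iff hvs.vector_space_axioms avs.vector_space_axioms)
qed

text \<open>On each word the series is a finite sum, and its product with \<epsilon> - \<nu>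
  telescopes.\<close>

lemma conv_geometric:
  assumes "linear_HA \<nu>" "\<nu> (wclass []) = 0"
  shows "conv (\<lambda>h. conv_unit h - \<nu> h) (conv_geometric \<nu>) = conv_unit"
proof (rule linear_HA_eqI)
  note lin = linear_conv_pow[OF assms(1)] linear_conv_geometric[OF assms]
    linear_HA_diff[OF linear_conv_unit assms(1)]
  show "linear_HA (conv (\<lambda>h. conv_unit h - \<nu> h) (conv_geometric \<nu>))"
    by (simp add: linear_conv lin)
  fix w :: word
  \<comment> \<open>From \<open>?N\<close> on the powers vanish at every word no longer than w, so
    one cut-off serves all subwords of w.\<close>
  let ?N = "Suc (length w)" and ?\<nu> = "\<lambda>v. \<nu> (wclass v)" and ?P = "\<lambda>n v. conv_pow \<nu> n (wclass v)"
  let ?\<epsilon> = "\<lambda>v. conv_unit (wclass v)"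
  have geom: "conv_geometric \<nu> (wclass v) = (\<Sum>n<?N. ?P n v)" if "length v \<le> length w" for v
    using conv_pow_wclass_eq_0[OF assms] that by (intro conv_geometric_eq) auto
  have step: "wconv (\<lambda>v. ?\<epsilon> v - ?\<nu> v) (?P n) w = ?P n w - ?P (Suc n) w" for n
    by (simp add: wconv_diff_left conv_wclass assms lin conv_unit_wclass wconv_unit)
  \<comment> \<open>The factors are swapped because \<open>wconv_cong\<close> rewrites the left
    one.\<close>
  have "conv (\<lambda>h. conv_unit h - \<nu> h) (conv_geometric \<nu>) (wclass w) =
      wconv (\<lambda>v. conv_geometric \<nu> (wclass v)) (\<lambda>v. ?\<epsilon> v - ?\<nu> v) w"
    by (simp add: conv_wclass lin wconv_commute)
  also have "\<dots> = wconv (\<lambda>v. \<Sum>n<?N. ?P n v) (\<lambda>v. ?\<epsilon> v - ?\<nu> v) w"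
    by (rule wconv_cong) (rule geom)
  also have "\<dots> = (\<Sum>n<?N. wconv (\<lambda>v. ?\<epsilon> v - ?\<nu> v) (?P n) w)"
    by (simp only: wconv_sum_left wconv_commute)
  also have "\<dots> = ?P 0 w - ?P ?N w"
    unfolding step by (rule sum_lessThan_telescope')
  also have "\<dots> = conv_unit (wclass w)"
    using conv_pow_wclass_eq_0[OF assms, of w ?N] by simp
  finally show "conv (\<lambda>h. conv_unit h - \<nu> h) (conv_geometric \<nu>) (wclass w) = conv_unit (wclass w)" .
qed (rule linear_conv_unit)

lemma conv_inverse_eq:
  assumes "linear_HA \<alpha>" "linear_HA \<beta>" "conv \<alpha> \<beta> = conv_unit" "\<beta> (wclass []) = 1"
  shows "conv_inverse \<alpha> = \<beta>"
  unfolding conv_inverse_def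
proof (rule the_equality)
  show "linear_HA \<beta> \<and> \<beta> (wclass []) = 1 \<and> conv \<alpha> \<beta> = conv_unit \<and> conv \<beta> \<alpha> = conv_unit"
    using assms conv_commute[of \<beta> \<alpha>] by simp
  show "\<gamma> = \<beta>" if "linear_HA \<gamma> \<and> \<gamma> (wclass []) = 1 \<and> conv \<alpha> \<gamma> = conv_unit \<and> conv \<gamma> \<alpha> = conv_unit" for \<gamma>
    using that assms by (blast intro: conv_left_inverse_unique[of \<alpha>])
qed

lemma conv_inverse:
  assumes "linear_HA \<alpha>" "\<alpha> (wclass []) = 1"
  shows "linear_HA (conv_inverse \<alpha>)" "conv \<alpha> (conv_inverse \<alpha>) = conv_unit"
proof -
  \<comment> \<open>Then \<alpha> = \<epsilon> - \<nu>, and \<nu> vanishes at the empty word because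
    \<alpha> is 1 there.\<close>
  define \<nu> where "\<nu> h = conv_unit h - \<alpha> h" for h
  have \<nu>: "linear_HA \<nu>" "\<nu> (wclass []) = 0"
    unfolding \<nu>_def using assms by (auto intro: linear_HA_diff linear_conv_unit simp: conv_unit_wclass)
  have "(\<lambda>h. conv_unit h - \<nu> h) = \<alpha>"
    by (auto simp: \<nu>_def)
  then have inv: "conv \<alpha> (conv_geometric \<nu>) = conv_unit"
    using conv_geometric[OF \<nu>] by simp
  note lin = linear_conv_geometric[OF \<nu>]
  have "conv_geometric \<nu> (wclass []) = 1"
    using conv_wclass[OF assms(1) lin, of "[]"] assms(2) by (simp add: inv conv_unit_wclass)
  then have "conv_inverse \<alpha> = conv_geometric \<nu>"
    by (intro conv_inverse_eq assms lin inv)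
  then show "linear_HA (conv_inverse \<alpha>)" "conv \<alpha> (conv_inverse \<alpha>) = conv_unit"
    by (simp_all add: lin inv)
qed

section \<open>Characters\<close>

definition wchar :: "rat fls \<Rightarrow> word \<Rightarrow> rat fls" where
  "wchar \<eta> = chr.wval \<eta>"

definition character :: "rat fls \<Rightarrow> H0 \<Rightarrow> rat fls" where
  "character \<eta> = chr.hval \<eta>"

lemma wchar_simps [simp]:
  "wchar \<eta> [] = 1"
  "wchar \<eta> (Ld # w) = fls_deriv (wchar \<eta> w)"
  "wchar \<eta> (Ly # w) = \<eta> * wchar \<eta> w"
  unfolding wchar_def by (simp_all only: chr.wval_Nil chr.wval_Cons chr.act.simps)

lemma linear_character: "linear_HA (character \<eta>)"
  unfolding character_def by (rule chr.linear_hval)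

lemma character_wclass [simp]: "character \<eta> (wclass w) = wchar \<eta> w"
  unfolding character_def wchar_def by (rule chr.hval_wclass)

lemma wconv_deriv:
  fixes f g :: "'x list \<Rightarrow> rat fls"
  shows "wconv (\<lambda>v. fls_deriv (f v)) g w + wconv f (\<lambda>v. fls_deriv (g v)) w = fls_deriv (wconv f g w)"
proof (induction w arbitrary: f g)
  case (Cons x w)
  show ?case
    unfolding wconv.simps fls_deriv_add Cons[symmetric] by (simp only: add_ac)
qed simp

text \<open>The letter d acts on a product by the Leibniz rule, while y multiplies one factor by
  \<eta> or the other by \<theta>, which adds up to \<eta> + \<theta>.\<close>

lemma wconv_wchar:
  "wconv (wchar \<eta>) (wchar \<theta>) w = wchar (\<eta> + \<theta>) w"
proof (induction w)
  case (Cons x w)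
  show ?case
    by (cases x)
      (simp_all add: wconv_deriv wconv_mult_left wconv_mult_right Cons distrib_right)
qed simp

lemma wchar_zero: "wchar 0 w = (if w = [] then 1 else 0)"
proof (induction w)
  case (Cons x w)
  then show ?case
    by (cases x) simp_all
qed simp

lemma conv_character: "conv (character \<eta>) (character \<theta>) = character (\<eta> + \<theta>)"
  by (rule linear_HA_eqI) (simp_all add: linear_conv linear_character conv_wclass wconv_wchar)

lemma character_zero: "character 0 = conv_unit"
  by (rule linear_HA_eqI)
    (simp_all add: linear_character linear_conv_unit conv_unit_wclass wchar_zero)

lemma conv_inverse_character: "conv_inverse (character \<eta>) = character (- \<eta>)"
  by (rule conv_inverse_eq) (simp_all add: linear_character conv_character character_zero)

lemma wchar_replicate_d: "wchar \<eta> (replicate k Ld @ w) = (fls_deriv ^^ k) (wchar \<eta> w)"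
  by (induction k) simp_all

lemma dy_word_Cons: "dy_word (k # ks) = replicate k Ld @ Ly # dy_word ks"
  by (simp add: dy_word_def)

lemma wchar_dy_word:
  "wchar \<eta> (dy_word ks) = foldr (\<lambda>k g. (fls_deriv ^^ k) (\<eta> * g)) ks 1"
  by (induction ks) (simp_all add: dy_word_Cons wchar_replicate_d, simp add: dy_word_def)

text \<open>Connects the words on which \<open>phi\<close> is prescribed with those that determine a
  linear map. A leading y opens a block with exponent 0, a leading d raises the first
  exponent.\<close>

lemma Y_word_eq_dy_word:
  assumes "w \<in> Y_words"
  obtains ks where "w = dy_word ks"
proof -
  have "\<exists>ks. w = dy_word ks" if "w = [] \<or> last w = Ly" for w
    using that
  proof (induction w)
    case Nil
    show ?case
      by (rule exI[of _ "[]"]) (simp add: dy_word_def)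
  next
    case (Cons x w)
    then obtain ks where ks: "w = dy_word ks"
      by (cases "w = []") auto
    show ?case
    proof (cases x)
      case Ly
      then show ?thesis
        by (intro exI[of _ "0 # ks"]) (simp add: ks dy_word_Cons)
    next
      case Ld
      with Cons.prems have "w \<noteq> []"
        by auto
      then obtain k ks' where "ks = k # ks'"
        using ks by (cases ks) (auto simp: dy_word_def)
      then show ?thesis
        by (intro exI[of _ "Suc k # ks'"]) (simp add: ks dy_word_Cons Ld)
    qed
  qed
  moreover have "w = [] \<or> last w = Ly"
    using assms by (auto simp: Y_words_def)
  ultimately show thesis
    using that by blast
qed

lemma phi_eq: "phi = character xi"
  unfolding phi_def
proof (rule the_equality)
  show "linear_HA (character xi) \<and>
    (\<forall>ks. character xi (wclass (dy_word ks)) = foldr (\<lambda>k g. (fls_deriv ^^ k) (xi * g)) ks 1)"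
    by (simp add: linear_character wchar_dy_word)
  show "f = character xi" if "linear_HA f \<and>
    (\<forall>ks. f (wclass (dy_word ks)) = foldr (\<lambda>k g. (fls_deriv ^^ k) (xi * g)) ks 1)" for f
    using that
    by (intro linear_eq_on_Y_words[of ascale])
      (auto simp: linear_character wchar_dy_word elim!: Y_word_eq_dy_word)
qed

section \<open>The Birkhoff decomposition\<close>

lemma A_plus_closed:
  assumes "f \<in> A_plus" "g \<in> A_plus"
  shows "f + g \<in> A_plus" "ascale c f \<in> A_plus" "fls_deriv f \<in> A_plus" "f * g \<in> A_plus"
    and "fls_nth (f * g) 0 = fls_nth f 0 * fls_nth g 0"
proof -
  have fps: "h = fps_to_fls (fls_regpart h)" if "h \<in> A_plus" for h
    using that by (intro fls_eqI) (auto simp: A_plus_def)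
  have fg: "f * g = fps_to_fls (fls_regpart f * fls_regpart g)"
    using fps[OF assms(1)] fps[OF assms(2)] by (metis fls_times_fps_to_fls)
  show "f * g \<in> A_plus" "fls_nth (f * g) 0 = fls_nth f 0 * fls_nth g 0"
    unfolding fg by (simp_all add: A_plus_def)
  show "fls_deriv f \<in> A_plus"
    unfolding A_plus_def
  proof (intro CollectI allI impI)
    \<comment> \<open>At n = -1 the constant term enters, but with the factor n + 1 = 0.\<close>
    show "fls_nth (fls_deriv f) n = 0" if "n < 0" for n
      using that assms(1) by (cases "n = -1") (auto simp: A_plus_def)
  qed
qed (use assms in \<open>auto simp: A_plus_def ascale_def\<close>)

lemma A_minus_closed:
  assumes "f \<in> A_minus" "g \<in> A_minus"
  shows "f + g \<in> A_minus" "ascale c f \<in> A_minus" "fls_deriv f \<in> A_minus" "f * g \<in> A_minus"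
proof -
  have "fls_nth (f * g) n = 0" if "n \<ge> 0" for n
    unfolding fls_times_nth(2)
  proof (rule sum.neutral, rule ballI)
    fix i
    \<comment> \<open>If i is negative then n - i is positive, so one of the factors is
      zero.\<close>
    show "fls_nth f i * fls_nth g (n - i) = 0"
      using assms that by (cases "i \<ge> 0") (auto simp: A_minus_def)
  qed
  then show "f * g \<in> A_minus"
    by (simp add: A_minus_def)
qed (use assms in \<open>auto simp: A_minus_def ascale_def\<close>)

lemma A_plus_A_minus: "f \<in> A_plus \<Longrightarrow> f \<in> A_minus \<Longrightarrow> f = 0"
  unfolding A_plus_def A_minus_def by (intro fls_eqI) (auto simp: not_le[symmetric])

lemma wchar_A_plus: "\<eta> \<in> A_plus \<Longrightarrow> wchar \<eta> w \<in> A_plus"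
proof (induction w)
  case (Cons x w)
  then show ?case
    by (cases x) (auto intro: A_plus_closed)
qed (simp add: A_plus_def)

lemma wchar_A_minus: "\<eta> \<in> A_minus \<Longrightarrow> w \<noteq> [] \<Longrightarrow> wchar \<eta> w \<in> A_minus"
proof (induction w)
  case (Cons x w)
  \<comment> \<open>This serves the word d, whose value is the derivative of 1.\<close>
  have "0 \<in> A_minus"
    by (simp add: A_minus_def)
  with Cons show ?case
    by (cases x; cases "w = []") (auto intro: A_minus_closed)
qed simp

lemma character_A_plus: "\<eta> \<in> A_plus \<Longrightarrow> character \<eta> h \<in> A_plus"
  by (induction h rule: H0_induct)
    (simp_all add: wchar_A_plus linear_add[OF linear_character] linear_scale[OF linear_character]
      A_plus_closed)

text \<open>Only the empty word has a value outside \<open>A_minus\<close>, namely 1, and the counit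
  removes it. On the kernel of the counit this is the condition imposed on
  \<phi>\<open>\<^sub>-\<close>.\<close>

lemma character_A_minus:
  assumes "\<eta> \<in> A_minus"
  shows "character \<eta> h - fls_const (counit h) \<in> A_minus"
proof (induction h rule: H0_induct)
  case (wclass w)
  show ?case
    using wchar_A_minus[OF assms, of w] by (auto simp: counit_wclass A_minus_def)
next
  case (add g h)
  have "counit (g + h) = counit g + counit h"
    by (simp add: counit_eq linear_add[OF trivial.linear_hval])
  then show ?case
    using A_minus_closed(1)[OF add]
    by (simp add: linear_add[OF linear_character] algebra_simps flip: fls_plus_const)
next
  case (scale c h)
  have "counit (hscale c h) = c * counit h"
    by (simp add: counit_eq linear_scale[OF trivial.linear_hval])
  moreover have "ascale c (fls_const r) = fls_const (c * r)" for r
    by (simp add: ascale_def)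
  ultimately show ?case
    using A_minus_closed(2)[OF scale scale, of c]
    by (simp add: linear_scale[OF linear_character] avs.scale_right_diff_distrib)
qed

definition xi_plus :: "rat fls" where
  "xi_plus = fps_to_fls (fls_regpart xi)"

text \<open>The second character belongs to minus the polar part of \<xi>, because
  \<phi>\<open>\<^sub>-\<close> enters through its inverse: -(\<open>xi_plus - xi\<close>) +
  \<open>xi_plus\<close> = \<open>xi\<close>.\<close>

lemma birkhoff_exists: "birkhoff (character xi_plus) (character (xi_plus - xi))"
proof -
  have plus: "xi_plus \<in> A_plus"
    by (simp add: xi_plus_def A_plus_def)
  have minus: "xi_plus - xi \<in> A_minus"
    by (simp add: xi_plus_def A_minus_def)
  have "phi = conv (conv_inverse (character (xi_plus - xi))) (character xi_plus)"
    by (simp add: phi_eq conv_inverse_character conv_character)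
  moreover have "character (xi_plus - xi) h \<in> {fls_const c + a | c a. a \<in> A_minus}" for h
  proof -
    have "character (xi_plus - xi) h =
        fls_const (counit h) + (character (xi_plus - xi) h - fls_const (counit h))"
      by simp
    then show ?thesis
      using character_A_minus[OF minus, of h] by blast
  qed
  moreover have "character (xi_plus - xi) h \<in> A_minus" if "counit h = 0" for h
    using character_A_minus[OF minus, of h] that by simp
  ultimately show ?thesis
    by (simp add: birkhoff_def linear_character character_A_plus plus)
qed

text \<open>By induction on the length of w, the difference of the two minus parts at w equals that
  of the two plus parts. It then lies in \<open>A_minus\<close> and \<open>A_plus\<close>, hence is
  zero.\<close>

lemma birkhoff_unique:
  assumes "birkhoff p m" "birkhoff p' m'"
  shows "p = p'" "m = m'"
proof -
  \<comment> \<open>The decomposition is rewritten without an inverse, which makes it linear in both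
    parts.\<close>
  have conv: "conv \<mu> phi = \<pi> \<and> linear_HA \<pi> \<and> linear_HA \<mu> \<and> \<mu> (wclass []) = 1 \<and>
      (\<forall>h. \<pi> h \<in> A_plus) \<and> (\<forall>h. counit h = 0 \<longrightarrow> \<mu> h \<in> A_minus)"
    if "birkhoff \<pi> \<mu>" for \<pi> \<mu>
  proof -
    have \<mu>: "linear_HA \<mu>" "\<mu> (wclass []) = 1" and \<pi>: "linear_HA \<pi>"
      and phi: "phi = conv (conv_inverse \<mu>) \<pi>"
      using that by (auto simp: birkhoff_def)
    have "conv \<mu> phi = \<pi>"
      unfolding phi
      by (simp add: conv_assoc[symmetric] \<mu> \<pi> conv_inverse conv_unit_left)
    then show ?thesis
      using that by (auto simp: birkhoff_def)
  qed
  note pm = conv[OF assms(1)] and pm' = conv[OF assms(2)]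
  have lin: "linear_HA phi"
    by (simp add: phi_eq linear_character)
  have phi1: "phi (wclass []) = 1"
    by (simp add: phi_eq)
  have "m (wclass w) = m' (wclass w)" for w
  proof (induction w rule: length_induct)
    case (1 w)
    show ?case
    proof (cases "w = []")
      case False
      let ?d = "\<lambda>v. m (wclass v) - m' (wclass v)"
      have "wconv ?d (\<lambda>v. phi (wclass v)) w = p (wclass w) - p' (wclass w)"
        using pm pm' by (auto simp: wconv_diff_left lin simp flip: conv_wclass)
      \<comment> \<open>The minus parts agree on shorter words by the induction hypothesis, so only
        the leading term remains.\<close>
      moreover have "wconv ?d (\<lambda>v. phi (wclass v)) w = ?d w * phi (wclass [])"
        using 1 by (intro wconv_lead) simp
      ultimately have eq: "?d w = p (wclass w) - p' (wclass w)"
        by (simp add: phi1)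
      have "p (wclass w) - p' (wclass w) \<in> A_plus"
        using pm pm' by (simp add: A_plus_def)
      moreover have "?d w \<in> A_minus"
        using pm pm' False by (simp add: A_minus_def counit_wclass)
      ultimately have "?d w = 0"
        using eq A_plus_A_minus by metis
      then show ?thesis
        by simp
    qed (use pm pm' in simp)
  qed
  then show "m = m'"
    using pm pm' by (intro linear_HA_eqI) auto
  then show "p = p'"
    using pm pm' by auto
qed

lemma phi_plus_eq: "phi_plus = character xi_plus"
proof -
  have "(THE (\<phi>p, \<phi>m). birkhoff \<phi>p \<phi>m) = (character xi_plus, character (xi_plus - xi))"
    by (rule the_equality) (use birkhoff_exists birkhoff_unique in blast)+
  then show ?thesis
    by (simp add: phi_plus_def)
qed

section \<open>Renormalized values\<close>

lemma funpow_deriv_mult: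
  fixes f g :: "rat fls"
  shows "(fls_deriv ^^ n) (f * g) =
    (\<Sum>i\<le>n. of_nat (n choose i) * ((fls_deriv ^^ i) f * (fls_deriv ^^ (n - i)) g))"
proof (induction n)
  case (Suc n)
  let ?f = "\<lambda>i. (fls_deriv ^^ i) f" and ?g = "\<lambda>i. (fls_deriv ^^ i) g"
  have D: "fls_deriv (of_nat c * (?f i * ?g j)) =
      of_nat c * (?f (Suc i) * ?g j) + of_nat c * (?f i * ?g (Suc j))" for c i j
    by (simp add: algebra_simps)
  \<comment> \<open>The added term i = \<open>Suc n\<close> has the coefficient
    \<open>n choose Suc n\<close>, which is 0; the longer range allows an index shift.\<close>
  have "(\<Sum>i\<le>n. of_nat (n choose i) * (?f i * ?g (Suc (n - i)))) =
      (\<Sum>i\<le>Suc n. of_nat (n choose i) * (?f i * ?g (Suc n - i)))"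
    by (simp add: Suc_diff_le)
  also have "\<dots> = ?f 0 * ?g (Suc n) +
      (\<Sum>i\<le>n. of_nat (n choose Suc i) * (?f (Suc i) * ?g (n - i)))"
    unfolding sum.atMost_Suc_shift by simp
  finally have shift: "(\<Sum>i\<le>n. of_nat (n choose i) * (?f i * ?g (Suc (n - i)))) = \<dots>" .
  have "(fls_deriv ^^ Suc n) (f * g) =
      (\<Sum>i\<le>n. of_nat (n choose i) * (?f (Suc i) * ?g (n - i))) +
      (\<Sum>i\<le>n. of_nat (n choose i) * (?f i * ?g (Suc (n - i))))"
    by (simp only: funpow.simps o_apply Suc.IH fls_deriv_sum sum.distrib D)
  also have "\<dots> = (\<Sum>i\<le>Suc n. of_nat (Suc n choose i) * (?f i * ?g (Suc n - i)))"
    unfolding shift sum.atMost_Suc_shift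
    by (simp add: distrib_right sum.distrib)
  finally show ?case .
qed simp

lemma zeta_EMS_eq: "zeta_EMS ks = fls_nth (wchar xi_plus (dy_word (rev ks))) 0"
  by (simp add: zeta_EMS_def phi_plus_eq)

lemma A_plus_funpow_deriv: "f \<in> A_plus \<Longrightarrow> (fls_deriv ^^ n) f \<in> A_plus"
  by (induction n) (auto intro: A_plus_closed)

lemma fls_nth_0_sum: "fls_nth (\<Sum>i\<in>I. f i) 0 = (\<Sum>i\<in>I. fls_nth (f i) 0)"
  by (induction I rule: infinite_finite_induct) simp_all

text \<open>Apply the Leibniz rule to the outermost derivative of order k and take constant terms,
  which is multiplicative on \<open>A_plus\<close>.\<close>

lemma zeta_EMS_rec:
  "zeta_EMS (ks @ [l, k]) =
     (\<Sum>i\<le>k. of_nat (k choose i) * zeta_EMS [i] * zeta_EMS (ks @ [l + (k - i)]))"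
proof -
  \<comment> \<open>Reversal puts the last argument first, so \<open>?v\<close> is the value of the
    tail common to the words on both sides.\<close>
  let ?D = "\<lambda>i. fls_deriv ^^ i" and ?v = "wchar xi_plus (Ly # dy_word (rev ks))"
  have plus: "xi_plus \<in> A_plus"
    by (simp add: xi_plus_def A_plus_def)
  have single: "zeta_EMS [i] = fls_nth (?D i xi_plus) 0" for i
    by (simp add: zeta_EMS_eq wchar_dy_word)
  have snoc: "zeta_EMS (ks @ [j]) = fls_nth (?D j ?v) 0" for j
    by (simp only: zeta_EMS_eq rev_append rev.simps append.simps dy_word_Cons wchar_replicate_d)
  have "?D (k - i) (?D l ?v) = ?D (l + (k - i)) ?v" for i
    by (simp only: funpow_add o_apply add.commute[of l])
  moreover have "zeta_EMS (ks @ [l, k]) = fls_nth (?D k (xi_plus * ?D l ?v)) 0"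
    by (simp add: zeta_EMS_eq dy_word_Cons wchar_replicate_d)
  moreover have "fls_nth (of_nat c * (?D i xi_plus * ?D j ?v)) 0 =
      of_nat c * (fls_nth (?D i xi_plus) 0 * fls_nth (?D j ?v) 0)" for c i j
  proof -
    have "fls_nth (?D i xi_plus * ?D j ?v) 0 = fls_nth (?D i xi_plus) 0 * fls_nth (?D j ?v) 0"
      by (intro A_plus_closed A_plus_funpow_deriv wchar_A_plus plus)
    then show ?thesis
      by (simp only: fls_mult_of_nat_nth)
  qed
  ultimately show ?thesis
    by (simp only: funpow_deriv_mult fls_nth_0_sum single snoc mult.assoc)
qed

section \<open>Generating functions\<close>

lemma funpow_fps_deriv_nth:
  fixes f :: "'a::field_char_0 fps"
  shows "fps_nth ((fps_deriv ^^ n) f) k = fact (k + n) / fact k * fps_nth f (k + n)"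
proof (induction n arbitrary: k)
  case (Suc n)
  have step: "of_nat (Suc k) * (fact (Suc k + n) / fact (Suc k)) = (fact (k + Suc n) / fact k :: 'a)"
    by (simp add: fact_Suc[of k] del: of_nat_Suc fact_Suc)
  have "fps_nth ((fps_deriv ^^ Suc n) f) k =
      of_nat (Suc k) * (fact (Suc k + n) / fact (Suc k)) * fps_nth f (Suc k + n)"
    by (simp add: Suc.IH del: of_nat_Suc fact_Suc)
  also have "\<dots> = fact (k + Suc n) / fact k * fps_nth f (k + Suc n)"
    by (simp only: step) simp
  finally show ?case .
qed simp

text \<open>For exponential generating series the binomial convolution becomes a product. The shift
  of the index by l is an l-th derivative and accounts for the sign.\<close>

lemma h_EMS_rec: "h_EMS (ks @ [l]) = (-1) ^ l * h_op l (h_EMS ks)"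
proof (rule fps_ext)
  fix k
  have "fps_nth (h_EMS (ks @ [l])) k =
    (\<Sum>i\<le>k. (-1) ^ k / fact k * (of_nat (k choose i) *
       (of_rat (zeta_EMS [i]) * of_rat (zeta_EMS (ks @ [l + (k - i)])))))"
    by (simp only: h_EMS_def fps_nth_Abs_fps append.assoc append.simps zeta_EMS_rec of_rat_sum
        of_rat_mult of_rat_of_nat_eq sum_distrib_left mult.assoc)
  also have "\<dots> = (\<Sum>i\<le>k. (-1) ^ l * (fps_nth (h_EMS []) i *
       fps_nth ((fps_deriv ^^ l) (h_EMS ks)) (k - i)))"
  proof (rule sum.cong[OF refl])
    fix i
    assume "i \<in> {..k}"
    then obtain j where k: "k = i + j"
      by (auto simp: le_iff_add)
    have "(-1) ^ l * (fps_nth (h_EMS []) i * fps_nth ((fps_deriv ^^ l) (h_EMS ks)) j) =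
      (-1) ^ (l + l) * (-1) ^ (i + j) / (fact i * fact j) *
        (of_rat (zeta_EMS [i]) * of_rat (zeta_EMS (ks @ [l + j])))"
    proof -
      \<comment> \<open>Here a, b, c are the signs with exponents l, i, j, and F is the factorial of
        j + l, which cancels.\<close>
      have "a * (b / p * z * (F / q * (c * a / F * w))) = a * a * (b * c) / (p * q) * (z * w)"
        if "F \<noteq> 0" for a b c p q z w F :: complex
        using that by simp
      from this[OF fact_nonzero] show ?thesis
        by (simp only: h_EMS_def funpow_fps_deriv_nth fps_nth_Abs_fps append.simps power_add
            add.commute[of l j])
    qed
    also have "(-1 :: complex) ^ (l + l) = 1"
      by simp
    also have "1 * (-1) ^ (i + j) / (fact i * fact j) =
        (-1) ^ k / fact k * (of_nat (k choose i) :: complex)"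
      by (simp add: k binomial_fact)
    finally show "(-1) ^ k / fact k * (of_nat (k choose i) *
       (of_rat (zeta_EMS [i]) * of_rat (zeta_EMS (ks @ [l + (k - i)])))) =
       (-1) ^ l * (fps_nth (h_EMS []) i * fps_nth ((fps_deriv ^^ l) (h_EMS ks)) (k - i))"
      by (simp add: k)
  qed
  also have "\<dots> = fps_nth (fps_const ((-1) ^ l) * h_op l (h_EMS ks)) k"
    by (simp only: fps_mult_left_const_nth h_op_def fps_mult_nth[of "h_EMS []"] atMost_atLeast0
        sum_distrib_left)
  also have "fps_const ((-1) ^ l) = (-1 :: complex fps) ^ l"
    by (simp flip: fps_const_power)
  finally show "fps_nth (h_EMS (ks @ [l])) k = fps_nth ((-1) ^ l * h_op l (h_EMS ks)) k" .
qed

lemma h_op_sign: "h_op l ((-1) ^ n * f) = (-1) ^ n * h_op l f"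
proof -
  have "(fps_deriv ^^ l) (- f) = - (fps_deriv ^^ l) f" for f :: "complex fps"
    by (induction l) simp_all
  then show ?thesis
    by (cases "even n") (simp_all add: h_op_def)
qed

text \<open>\<open>fold\<close> applies the operator of the first index first, so that of the last
  index is outermost. The signs pass through by linearity.\<close>

lemma h_EMS_fold: "h_EMS ks = (-1) ^ sum_list ks * fold h_op ks (h_EMS [])"
proof (induction ks rule: rev_induct)
  case (snoc l ks)
  have "h_EMS (ks @ [l]) = (-1) ^ l * h_op l ((-1) ^ sum_list ks * fold h_op ks (h_EMS []))"
    by (simp add: h_EMS_rec flip: snoc.IH)
  then show ?case
    by (simp add: h_op_sign power_add mult.assoc mult.left_commute)
qed simp

theorem proposition3p3:
  fixes n :: nat and k :: "nat \<Rightarrow> nat"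
  assumes "n \<ge> 2"
  shows "zeta_EMS (map k [1..<n + 1]) =
           (\<Sum>(i, j) \<in> {(i, j). i + j = k n}.
              of_nat (k n choose i) * zeta_EMS [i] *
              zeta_EMS (map k [1..<n - 1] @ [k (n - 1) + j])) \<and>
         h_EMS (map k [1..<n]) =
           (-1) ^ (\<Sum>i = 1..n - 1. k i) * fold h_op (map k [1..<n]) (h_EMS [])"
proof
  obtain m where n: "n = Suc (Suc m)"
    using assms by (metis One_nat_def Suc_1 Suc_le_D Suc_le_mono)
  \<comment> \<open>The pairs are parametrised by their first entry.\<close>
  have "(\<Sum>(i, j) \<in> {(i, j). i + j = k n}. F i j) = (\<Sum>i\<le>k n. F i (k n - i))" for F :: "nat \<Rightarrow> nat \<Rightarrow> rat"
    by (rule sum.reindex_bij_witness[of _ "\<lambda>i. (i, k n - i)" fst]) (auto dest: sym)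
  then show "zeta_EMS (map k [1..<n + 1]) =
     (\<Sum>(i, j) \<in> {(i, j). i + j = k n}.
        of_nat (k n choose i) * zeta_EMS [i] *
        zeta_EMS (map k [1..<n - 1] @ [k (n - 1) + j]))"
    \<comment> \<open>With n = m + 2 the common prefix has m entries and is empty for n = 2.\<close>
    using zeta_EMS_rec[of "map k [1..<Suc m]" "k (Suc m)" "k n"] by (simp add: n)
  have "sum_list (map k [1..<n]) = (\<Sum>i = 1..n - 1. k i)"
    unfolding interv_sum_list_conv_sum_set_nat by (rule sum.cong) (auto simp: n)
  then show "h_EMS (map k [1..<n]) =
      (-1) ^ (\<Sum>i = 1..n - 1. k i) * fold h_op (map k [1..<n]) (h_EMS [])"
    using h_EMS_fold[of "map k [1..<n]"] by simp
qed

end
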